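(* Let $U\subset\mathbb R^l$ be nonempty and closed, let $\mathcal U_{ad}:=\{u\in L^2_{\mathbb F}(0,T;\mathbb R^l): u(t)\in U\text{ for a.e. }t\in[0,T],\text{ a.s.}\}$, and let $\bar u\in\mathcal U_{ad}$ be an optimal control of the control problem described in the context. Let $F:\Omega\times[0,T]\to\mathbb R^l$ be a $\mathcal B([0,T])\otimes\mathcal F$-measurable and $\mathbb F$-adapted process such that $$\mathbb E\int_0^T\langle F(t),v(t)\rangle dt\ge0\qquad\text{for all } v(\cdot)\in T^b_{\mathcal U_{ad}}(\bar u(\cdot)),$$ where $T^b_{\mathcal U_{ad}}(\bar u(\cdot))$ is the adjacent cone of $\mathcal U_{ad}$ at $\bar u(\cdot)$ in $L^2_{\mathbb F}(0,T;\mathbb R^l)$. Then for $\lambda\times\mathbb P$-almost every $(t,\omega)\in[0,T]\times\Omega$ ($\lambda$ being Lebesgue measure), $$\langle F(t),v\rangle\ge0\qquad\text{for all } v\in T^b_U(\bar u(t)).$$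
   Context: Setting. $T>0$; $(\Omega,\mathcal F,\mathbb F,\mathbb P)$ is a complete filtered probability space satisfying the usual conditions, $W$ a one-dimensional standard Wiener process on it, $\mathbb F=\{\mathcal F_t\}_{0\le t\le T}$ the natural filtration of $W$ augmented by all null sets. Adjacent cone. For a closed subset $K$ of a Banach space $X$ and $x\in K$, $T^b_K(x):=\{v\in X:\lim_{h\to0^+}\mathrm{dist}(x+hv,K)/h=0\}$. Spaces (for a Euclidean space $H$). $L^2_{\mathbb F}(0,T;H)$: $\mathcal F_T\otimes\mathcal B([0,T])$-measurable $\mathbb F$-adapted processes with $\mathbb E\int_0^T|X(r)|^2dr<\infty$. $L^2_{\mathbb F}(\Omega;C([0,T];H))$: $\mathbb F$-adapted processes with continuous paths and $\mathbb E\sup_r|X(r)|^2<\infty$. $C_{\mathbb F}([0,T];L^2(\Omega;H))$: $\mathbb F$-adapted processes continuous as maps $[0,T]\to L^2_{\mathcal F_T}(\Omega;H)$ (the $\mathcal F_T$-measurable square-integrable random variables), with $\sup_r\mathbb E|X(r)|^2<\infty$. $C([0,T];L^2_{\mathbb F}(0,T;H))$: fields $Z(t,s)$ with $s\mapsto Z(t,s)$ adapted on $[0,T]$ for every $t$, $t\mapsto Z(t,\cdot)$ continuous into $L^2_{\mathbb F}(0,T;H)$, and $\sup_t\mathbb E\int_0^T|Z(t,s)|^2ds<\infty$. $\mathcal H^2(0,T;H):=C_{\mathbb F}([0,T];L^2(\Omega;H))\times C([0,T];L^2_{\mathbb F}(0,T;H))$. Control problem. For $u\in\mathcal U_{ad}$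 the state $(X,Y,Z)\in C_{\mathbb F}([0,T];L^2(\Omega;\mathbb R^n))\times\mathcal H^2(0,T;\mathbb R^m)$ is the unique solution of $$X(t)=\varphi(t)+\int_0^t b(t,s,X(s),u(s))ds+\int_0^t\sigma(t,s,X(s),u(s))dW(s),$$ $$Y(t)=\psi(t,X(T))+\int_t^T g(t,s,X(s),Y(s),Z(t,s),u(s))ds-\int_t^T Z(t,s)dW(s),$$ both holding a.s. for every $t\in[0,T]$, with $r\mapsto\psi(t,X(T))+\int_r^T g(t,s,X(s),Y(s),Z(t,s),u(s))ds-\int_r^T Z(t,s)dW(s)$ in $L^2_{\mathbb F}(\Omega;C([0,T];\mathbb R^m))$ for every $t$. The cost is $J(u)=\mathbb E\int_0^T f(s,X(s),Y(s),Z(0,s),u(s))ds+\mathbb E\,h(X(T),Y(0))$, and $\bar u\in\mathcal U_{ad}$ is optimal if $J(\bar u)=\inf_{u\in\mathcal U_{ad}}J(u)$. Assumptions on the data of the control problem. $\varphi\in C_{\mathbb F}([0,T];L^2(\Omega;\mathbb R^n))$, $\psi(\cdot,0)\in C_{\mathbb F}([0,T];L^2(\Omega;\mathbb R^m))$ (where $\psi=\psi(t,x)$ is $\mathbb R^m$-valued and may depend on $\omega$); $b,\sigma:[0,T]^2\times\mathbb R^n\times U\times\Omega\to\mathbb R^n$ and $g:[0,T]^2\times\mathbb R^n\times\mathbb R^m\times\mathbb R^m\times U\times\Omega\to\mathbb R^m$ are measurable; $b,\sigma,g$ are progressively measurable in $s$ with the other arguments fixed; for a.e. $(t,s,\omega)\in[0,T]^2\times\Omega$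 the map $(x,y,z,u)\mapsto(b(t,s,x,u),\sigma(t,s,x,u),g(t,s,x,y,z,u),\psi(t,x))$ is continuously differentiable with uniformly bounded derivatives; $\sup_{t}\mathbb E[(\int_0^T|b(t,s,0,0)|ds)^2+\int_0^T|\sigma(t,s,0,0)|^2ds+(\int_0^T|g(t,s,0,0,0,0)|ds)^2]<\infty$; and there is a modulus of continuity $\rho:[0,\infty)\to[0,\infty)$ such that $|b(t,s,x,u)-b(t',s,x,u)|+|\sigma(t,s,x,u)-\sigma(t',s,x,u)|+|\psi(t,x)-\psi(t',x)|+|g(t,s,x,y,z,u)-g(t',s,x,y,z,u)|\le\rho(|t-t'|)[1+|x|+|y|+|z|+|u|]$ for all $t,t',s\in[0,T]$, $x\in\mathbb R^n$, $y,z\in\mathbb R^m$, $u\in U$. Moreover $f:[0,T]\times\mathbb R^n\times\mathbb R^m\times\mathbb R^m\times U\times\Omega\to\mathbb R$ and $h:\mathbb R^n\times\mathbb R^m\times\Omega\to\mathbb R$ are measurable, and $(x,y,z,u)\mapsto f(s,x,y,z,u)$, $(x,y)\mapsto h(x,y)$ are continuously differentiable with derivatives bounded by $L(1+|x|+|y|+|z|+|u|)$, $L>0$. *)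

theory Defs
  imports "HOL-Probability.Probability"
begin

text \<open>
  Processes are functions of time and sample point, restricted to times in \<open>{0..T}\<close>;
  values at other times are irrelevant. \<open>FF\<close> is the filtration, each \<open>FF t\<close> being used only
  through its space and its \<open>\<sigma>\<close>-algebra. Euclidean spaces are represented by types.
\<close>

section \<open>Adjacent cone and extended integrals\<close>

definition adjacent_cone :: "'a::real_normed_vector set \<Rightarrow> 'a \<Rightarrow> 'a set" where
  "adjacent_cone K x = {v. ((\<lambda>h. infdist (x + h *\<^sub>R v) K / h) \<longlongrightarrow> 0) (at_right 0)}"

text \<open>
  The Bochner integral of a non-integrable function is \<open>0\<close> by convention. The following notions
  are used where an integral is only required to make sense in \<open>[-\<infinity>, \<infinity>]\<close>
  (\<open>ennreal\<close> maps negative reals to \<open>0\<close>).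
\<close>

definition ext_integrable :: "'a measure \<Rightarrow> ('a \<Rightarrow> real) \<Rightarrow> bool" where
  "ext_integrable N f \<longleftrightarrow> f \<in> borel_measurable N \<and>
     ((\<integral>\<^sup>+x. ennreal (f x) \<partial>N) < \<infinity> \<or> (\<integral>\<^sup>+x. ennreal (- f x) \<partial>N) < \<infinity>)"

definition ext_integral :: "'a measure \<Rightarrow> ('a \<Rightarrow> real) \<Rightarrow> ereal" where
  "ext_integral N f =
     enn2ereal (\<integral>\<^sup>+x. ennreal (f x) \<partial>N) - enn2ereal (\<integral>\<^sup>+x. ennreal (- f x) \<partial>N)"

section \<open>The filtered probability space and the Wiener process\<close>

definition time_measure :: "real \<Rightarrow> real measure" where
  "time_measure T = restrict_space lborel {0..T}"

definition augmented_natural_filtration ::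
    "'w measure \<Rightarrow> (real \<Rightarrow> 'w \<Rightarrow> real) \<Rightarrow> real \<Rightarrow> 'w measure" where
  "augmented_natural_filtration M W t =
     sigma (space M) ({W s -` A \<inter> space M | s A. 0 \<le> s \<and> s \<le> t \<and> A \<in> sets borel} \<union> null_sets M)"

definition usual_conditions :: "real \<Rightarrow> 'w measure \<Rightarrow> (real \<Rightarrow> 'w measure) \<Rightarrow> bool" where
  "usual_conditions T M FF \<longleftrightarrow>
     (\<forall>t\<in>{0..T}. space (FF t) = space M \<and> sets (FF t) \<subseteq> sets M) \<and>
     (\<forall>s t. 0 \<le> s \<and> s \<le> t \<and> t \<le> T \<longrightarrow> sets (FF s) \<subseteq> sets (FF t)) \<and>
     null_sets M \<subseteq> sets (FF 0) \<and>
     (\<forall>t\<in>{0..<T}. sets (FF t) = (\<Inter>s\<in>{t<..T}. sets (FF s)))"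

definition wiener_process ::
    "real \<Rightarrow> 'w measure \<Rightarrow> (real \<Rightarrow> 'w measure) \<Rightarrow> (real \<Rightarrow> 'w \<Rightarrow> real) \<Rightarrow> bool" where
  "wiener_process T M FF W \<longleftrightarrow>
     (\<forall>t\<in>{0..T}. W t \<in> borel_measurable M \<and> W t \<in> borel_measurable (FF t)) \<and>
     (AE \<omega> in M. W 0 \<omega> = 0) \<and>
     (AE \<omega> in M. continuous_on {0..T} (\<lambda>t. W t \<omega>)) \<and>
     (\<forall>s t. 0 \<le> s \<and> s < t \<and> t \<le> T \<longrightarrow>
        distributed M lborel (\<lambda>\<omega>. W t \<omega> - W s \<omega>) (\<lambda>x. ennreal (normal_density 0 (sqrt (t - s)) x)) \<and>
        prob_space.indep_set M (sets (FF s))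
          (sets (vimage_algebra (space M) (\<lambda>\<omega>. W t \<omega> - W s \<omega>) borel)))"

definition wiener_space ::
    "real \<Rightarrow> 'w measure \<Rightarrow> (real \<Rightarrow> 'w measure) \<Rightarrow> (real \<Rightarrow> 'w \<Rightarrow> real) \<Rightarrow> bool" where
  "wiener_space T M FF W \<longleftrightarrow>
     prob_space M \<and> complete_measure M \<and> usual_conditions T M FF \<and> wiener_process T M FF W \<and>
     (\<forall>t\<in>{0..T}. sets (FF t) = sets (augmented_natural_filtration M W t))"

section \<open>Spaces of processes\<close>

definition adapted :: "real \<Rightarrow> (real \<Rightarrow> 'w measure) \<Rightarrow> (real \<Rightarrow> 'w \<Rightarrow> 'h::euclidean_space) \<Rightarrow> bool" where
  "adapted T FF X \<longleftrightarrow> (\<forall>t\<in>{0..T}. X t \<in> borel_measurable (FF t))"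

definition L2F ::
    "real \<Rightarrow> 'w measure \<Rightarrow> (real \<Rightarrow> 'w measure) \<Rightarrow> (real \<Rightarrow> 'w \<Rightarrow> 'h::euclidean_space) set" where
  "L2F T M FF = {X.
     (\<lambda>(t, \<omega>). X t \<omega>) \<in> borel_measurable (time_measure T \<Otimes>\<^sub>M FF T) \<and> adapted T FF X \<and>
     (\<integral>\<^sup>+\<omega>. (\<integral>\<^sup>+t. ennreal ((norm (X t \<omega>))\<^sup>2) \<partial>time_measure T) \<partial>M) < \<infinity>}"

definition L2_norm :: "real \<Rightarrow> 'w measure \<Rightarrow> (real \<Rightarrow> 'w \<Rightarrow> 'h::euclidean_space) \<Rightarrow> real" where
  "L2_norm T M X = sqrt (\<integral>\<omega>. (\<integral>t. (norm (X t \<omega>))\<^sup>2 \<partial>time_measure T) \<partial>M)"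

text \<open>
  The adjacent cone in \<open>L2F\<close>. The elements of \<open>L2F\<close> are processes rather than equivalence classes,
  so \<open>L2_norm\<close> is a seminorm here; the cone is the preimage of the one in the quotient space
  whenever \<open>K\<close> is closed under modification on null sets, as is the set of admissible controls.
\<close>

definition L2_adjacent_cone ::
    "real \<Rightarrow> 'w measure \<Rightarrow> (real \<Rightarrow> 'w measure) \<Rightarrow> (real \<Rightarrow> 'w \<Rightarrow> 'h::euclidean_space) set \<Rightarrow>
     (real \<Rightarrow> 'w \<Rightarrow> 'h) \<Rightarrow> (real \<Rightarrow> 'w \<Rightarrow> 'h) set" where
  "L2_adjacent_cone T M FF K x = {v \<in> L2F T M FF.
     ((\<lambda>h. (INF k\<in>K. L2_norm T M (\<lambda>t \<omega>. x t \<omega> + h *\<^sub>R v t \<omega> - k t \<omega>)) / h) \<longlongrightarrow> 0) (at_right 0)}"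

definition L2F_C ::
    "real \<Rightarrow> 'w measure \<Rightarrow> (real \<Rightarrow> 'w measure) \<Rightarrow> (real \<Rightarrow> 'w \<Rightarrow> 'h::euclidean_space) set" where
  "L2F_C T M FF = {X. adapted T FF X \<and> (\<forall>\<omega>\<in>space M. continuous_on {0..T} (\<lambda>t. X t \<omega>)) \<and>
     (\<integral>\<^sup>+\<omega>. (SUP r\<in>{0..T}. ennreal ((norm (X r \<omega>))\<^sup>2)) \<partial>M) < \<infinity>}"

definition CF_L2 ::
    "real \<Rightarrow> 'w measure \<Rightarrow> (real \<Rightarrow> 'w measure) \<Rightarrow> (real \<Rightarrow> 'w \<Rightarrow> 'h::euclidean_space) set" where
  "CF_L2 T M FF = {X. adapted T FF X \<and>
     (\<forall>t\<in>{0..T}. integrable M (\<lambda>\<omega>. (norm (X t \<omega>))\<^sup>2)) \<and>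
     (\<forall>t\<in>{0..T}. ((\<lambda>s. \<integral>\<omega>. (norm (X s \<omega> - X t \<omega>))\<^sup>2 \<partial>M) \<longlongrightarrow> 0) (at t within {0..T})) \<and>
     bdd_above ((\<lambda>t. \<integral>\<omega>. (norm (X t \<omega>))\<^sup>2 \<partial>M) ` {0..T})}"

definition C_L2F ::
    "real \<Rightarrow> 'w measure \<Rightarrow> (real \<Rightarrow> 'w measure) \<Rightarrow> (real \<Rightarrow> real \<Rightarrow> 'w \<Rightarrow> 'h::euclidean_space) set" where
  "C_L2F T M FF = {Z. (\<forall>t\<in>{0..T}. Z t \<in> L2F T M FF) \<and>
     (\<forall>t\<in>{0..T}. ((\<lambda>t'. L2_norm T M (\<lambda>s \<omega>. Z t' s \<omega> - Z t s \<omega>)) \<longlongrightarrow> 0) (at t within {0..T})) \<and>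
     bdd_above ((\<lambda>t. (L2_norm T M (Z t))\<^sup>2) ` {0..T})}"

section \<open>The Ito integral\<close>

text \<open>
  \<open>has_ito_integral M FF W a b Z I\<close> says that \<open>I\<close> is a version of the integral of \<open>Z\<close> against \<open>W\<close>
  over \<open>{a..b}\<close>: the mean-square limit of the integrals of bounded simple adapted processes
  approximating \<open>Z\<close>. The integrand is only required to be measurable for the completed product
  measure, because the coefficients of the state equation are measurable on \<open>U\<close> only, while a control
  takes values in \<open>U\<close> only almost everywhere.
\<close>

definition has_ito_integral ::
    "'w measure \<Rightarrow> (real \<Rightarrow> 'w measure) \<Rightarrow> (real \<Rightarrow> 'w \<Rightarrow> real) \<Rightarrow> real \<Rightarrow> real \<Rightarrow>
     (real \<Rightarrow> 'w \<Rightarrow> 'h::euclidean_space) \<Rightarrow> ('w \<Rightarrow> 'h) \<Rightarrow> bool" where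
  "has_ito_integral M FF W a b Z I \<longleftrightarrow>
     I \<in> borel_measurable M \<and>
     (\<lambda>(s, \<omega>). Z s \<omega>) \<in> borel_measurable (completion (restrict_space lborel {a..b} \<Otimes>\<^sub>M M)) \<and>
     (\<exists>(N :: nat \<Rightarrow> nat) (p :: nat \<Rightarrow> nat \<Rightarrow> real) (\<xi> :: nat \<Rightarrow> nat \<Rightarrow> 'w \<Rightarrow> 'h).
        (\<forall>k. p k 0 = a \<and> p k (N k) = b \<and>
             (\<forall>i<N k. p k i \<le> p k (Suc i) \<and>
                \<xi> k i \<in> borel_measurable (FF (p k i)) \<and> bounded (\<xi> k i ` space M))) \<and>
        ((\<lambda>k. \<integral>\<^sup>+(s, \<omega>). ennreal ((norm
             ((\<Sum>i<N k. indicator {p k i<..p k (Suc i)} s *\<^sub>R \<xi> k i \<omega>) - Z s \<omega>))\<^sup>2)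
           \<partial>completion (restrict_space lborel {a..b} \<Otimes>\<^sub>M M)) \<longlonglongrightarrow> 0) \<and>
        ((\<lambda>k. \<integral>\<^sup>+\<omega>. ennreal ((norm
             ((\<Sum>i<N k. (W (p k (Suc i)) \<omega> - W (p k i) \<omega>) *\<^sub>R \<xi> k i \<omega>) - I \<omega>))\<^sup>2) \<partial>M) \<longlonglongrightarrow> 0))"

section \<open>The control problem\<close>

record ('w, 'n::finite, 'm::finite, 'l::finite) volterra_data =
  fwd_free :: "real \<Rightarrow> 'w \<Rightarrow> real ^ 'n"  \<comment> \<open>\<open>\<phi>(t)\<close>\<close>
  bwd_free :: "real \<Rightarrow> real ^ 'n \<Rightarrow> 'w \<Rightarrow> real ^ 'm"  \<comment> \<open>\<open>\<psi>(t, x)\<close>\<close>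
  drift :: "real \<Rightarrow> real \<Rightarrow> real ^ 'n \<Rightarrow> real ^ 'l \<Rightarrow> 'w \<Rightarrow> real ^ 'n"  \<comment> \<open>\<open>b(t, s, x, u)\<close>\<close>
  diffusion :: "real \<Rightarrow> real \<Rightarrow> real ^ 'n \<Rightarrow> real ^ 'l \<Rightarrow> 'w \<Rightarrow> real ^ 'n"  \<comment> \<open>\<open>\<sigma>(t, s, x, u)\<close>\<close>
  gen :: "real \<Rightarrow> real \<Rightarrow> real ^ 'n \<Rightarrow> real ^ 'm \<Rightarrow> real ^ 'm \<Rightarrow> real ^ 'l \<Rightarrow> 'w \<Rightarrow> real ^ 'm"
    \<comment> \<open>\<open>g(t, s, x, y, z, u)\<close>\<close>
  run_cost :: "real \<Rightarrow> real ^ 'n \<Rightarrow> real ^ 'm \<Rightarrow> real ^ 'm \<Rightarrow> real ^ 'l \<Rightarrow> 'w \<Rightarrow> real"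
    \<comment> \<open>\<open>f(s, x, y, z, u)\<close>\<close>
  end_cost :: "real ^ 'n \<Rightarrow> real ^ 'm \<Rightarrow> 'w \<Rightarrow> real"  \<comment> \<open>\<open>h(x, y)\<close>\<close>

definition admissible ::
    "real \<Rightarrow> 'w measure \<Rightarrow> (real \<Rightarrow> 'w measure) \<Rightarrow> (real ^ 'l::finite) set \<Rightarrow> (real \<Rightarrow> 'w \<Rightarrow> real ^ 'l) set" where
  "admissible T M FF U = {u \<in> L2F T M FF. AE \<omega> in M. AE t in time_measure T. u t \<omega> \<in> U}"

subsection \<open>Assumptions on the data\<close>

definition progressive ::
    "real \<Rightarrow> (real \<Rightarrow> 'w measure) \<Rightarrow> (real \<Rightarrow> 'w \<Rightarrow> 'h::euclidean_space) \<Rightarrow> bool" where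
  "progressive T FF X \<longleftrightarrow>
     (\<forall>r\<in>{0..T}. (\<lambda>(s, \<omega>). X s \<omega>) \<in> borel_measurable (restrict_space borel {0..r} \<Otimes>\<^sub>M FF r))"

text \<open>
  Continuous differentiability on a set that need not be open, with a bound on the derivative.
  Derivatives are taken within the set and need not be unique (for instance at isolated points of \<open>U\<close>).
\<close>

definition C1_deriv_bound ::
    "'a::real_normed_vector set \<Rightarrow> ('a \<Rightarrow> 'b::real_normed_vector) \<Rightarrow> ('a \<Rightarrow> real) \<Rightarrow> bool" where
  "C1_deriv_bound S G B \<longleftrightarrow>
     (\<exists>G' :: 'a \<Rightarrow> 'a \<Rightarrow>\<^sub>L 'b. continuous_on S G' \<and>
        (\<forall>p\<in>S. (G has_derivative blinfun_apply (G' p)) (at p within S) \<and> norm (G' p) \<le> B p))"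

definition modulus_of_continuity :: "(real \<Rightarrow> real) \<Rightarrow> bool" where
  "modulus_of_continuity \<rho> \<longleftrightarrow> \<rho> 0 = 0 \<and> continuous_on {0..} \<rho> \<and> mono_on {0..} \<rho>"

definition state_assumptions ::
    "real \<Rightarrow> 'w measure \<Rightarrow> (real \<Rightarrow> 'w measure) \<Rightarrow> (real ^ 'l::finite) set \<Rightarrow>
     ('w, 'n::finite, 'm::finite, 'l::finite) volterra_data \<Rightarrow> bool" where
  "state_assumptions T M FF U D \<longleftrightarrow>
     fwd_free D \<in> CF_L2 T M FF \<and>
     (\<lambda>t. bwd_free D t 0) \<in> CF_L2 T M FF \<and>
     (\<lambda>(t, s, x, u, \<omega>). drift D t s x u \<omega>) \<in> borel_measurable
       (time_measure T \<Otimes>\<^sub>M time_measure T \<Otimes>\<^sub>M borel \<Otimes>\<^sub>M restrict_space borel U \<Otimes>\<^sub>M M) \<and>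
     (\<lambda>(t, s, x, u, \<omega>). diffusion D t s x u \<omega>) \<in> borel_measurable
       (time_measure T \<Otimes>\<^sub>M time_measure T \<Otimes>\<^sub>M borel \<Otimes>\<^sub>M restrict_space borel U \<Otimes>\<^sub>M M) \<and>
     (\<lambda>(t, s, x, y, z, u, \<omega>). gen D t s x y z u \<omega>) \<in> borel_measurable
       (time_measure T \<Otimes>\<^sub>M time_measure T \<Otimes>\<^sub>M borel \<Otimes>\<^sub>M borel \<Otimes>\<^sub>M borel \<Otimes>\<^sub>M
        restrict_space borel U \<Otimes>\<^sub>M M) \<and>
     (\<forall>t\<in>{0..T}. \<forall>x y z. \<forall>u\<in>U.
        progressive T FF (\<lambda>s. drift D t s x u) \<and>
        progressive T FF (\<lambda>s. diffusion D t s x u) \<and>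
        progressive T FF (\<lambda>s. gen D t s x y z u)) \<and>
     (\<exists>C. AE (t, s, \<omega>) in time_measure T \<Otimes>\<^sub>M time_measure T \<Otimes>\<^sub>M M.
        C1_deriv_bound (UNIV \<times> UNIV \<times> UNIV \<times> U)
          (\<lambda>(x, y, z, u). (drift D t s x u \<omega>, diffusion D t s x u \<omega>,
                            gen D t s x y z u \<omega>, bwd_free D t x \<omega>))
          (\<lambda>_. C)) \<and>
     (SUP t\<in>{0..T}. \<integral>\<^sup>+\<omega>.
        ((\<integral>\<^sup>+s. ennreal (norm (drift D t s 0 0 \<omega>)) \<partial>time_measure T)\<^sup>2
         + (\<integral>\<^sup>+s. ennreal ((norm (diffusion D t s 0 0 \<omega>))\<^sup>2) \<partial>time_measure T)
         + (\<integral>\<^sup>+s. ennreal (norm (gen D t s 0 0 0 0 \<omega>)) \<partial>time_measure T)\<^sup>2) \<partial>M) < \<infinity> \<and>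
     (\<exists>\<rho>. modulus_of_continuity \<rho> \<and>
        (AE \<omega> in M. \<forall>t\<in>{0..T}. \<forall>t'\<in>{0..T}. \<forall>s\<in>{0..T}. \<forall>x y z. \<forall>u\<in>U.
           norm (drift D t s x u \<omega> - drift D t' s x u \<omega>)
           + norm (diffusion D t s x u \<omega> - diffusion D t' s x u \<omega>)
           + norm (bwd_free D t x \<omega> - bwd_free D t' x \<omega>)
           + norm (gen D t s x y z u \<omega> - gen D t' s x y z u \<omega>)
           \<le> \<rho> \<bar>t - t'\<bar> * (1 + norm x + norm y + norm z + norm u)))"

definition cost_assumptions ::
    "real \<Rightarrow> 'w measure \<Rightarrow> (real ^ 'l::finite) set \<Rightarrow> ('w, 'n::finite, 'm::finite, 'l::finite) volterra_data \<Rightarrow> bool" where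
  "cost_assumptions T M U D \<longleftrightarrow>
     (\<lambda>(s, x, y, z, u, \<omega>). run_cost D s x y z u \<omega>) \<in> borel_measurable
       (time_measure T \<Otimes>\<^sub>M borel \<Otimes>\<^sub>M borel \<Otimes>\<^sub>M borel \<Otimes>\<^sub>M restrict_space borel U \<Otimes>\<^sub>M M) \<and>
     (\<lambda>(x, y, \<omega>). end_cost D x y \<omega>) \<in> borel_measurable (borel \<Otimes>\<^sub>M borel \<Otimes>\<^sub>M M) \<and>
     (\<exists>L>0.
        (AE (s, \<omega>) in time_measure T \<Otimes>\<^sub>M M.
           C1_deriv_bound (UNIV \<times> UNIV \<times> UNIV \<times> U) (\<lambda>(x, y, z, u). run_cost D s x y z u \<omega>)
             (\<lambda>(x, y, z, u). L * (1 + norm x + norm y + norm z + norm u))) \<and>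
        (AE \<omega> in M. C1_deriv_bound UNIV (\<lambda>(x, y). end_cost D x y \<omega>)
             (\<lambda>(x, y). L * (1 + norm x + norm y))))"

subsection \<open>State equation and cost\<close>

text \<open>
  \<open>V\<close> is a version of \<open>\<psi>(t, X(T)) + \<integral>\<^sub>r\<^sup>T g(t, s, X(s), Y(s), Z(t, s), u(s)) ds - \<integral>\<^sub>r\<^sup>T Z(t, s) dW(s)\<close>.
\<close>

definition bwd_rhs ::
    "real \<Rightarrow> 'w measure \<Rightarrow> (real \<Rightarrow> 'w measure) \<Rightarrow> (real \<Rightarrow> 'w \<Rightarrow> real) \<Rightarrow>
     ('w, 'n::finite, 'm::finite, 'l::finite) volterra_data \<Rightarrow> (real \<Rightarrow> 'w \<Rightarrow> real ^ 'l) \<Rightarrow> (real \<Rightarrow> 'w \<Rightarrow> real ^ 'n) \<Rightarrow>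
     (real \<Rightarrow> 'w \<Rightarrow> real ^ 'm) \<Rightarrow> (real \<Rightarrow> real \<Rightarrow> 'w \<Rightarrow> real ^ 'm) \<Rightarrow> real \<Rightarrow> real \<Rightarrow>
     ('w \<Rightarrow> real ^ 'm) \<Rightarrow> bool" where
  "bwd_rhs T M FF W D u X Y Z t r V \<longleftrightarrow>
     (AE \<omega> in M. integrable (lebesgue_on {r..T})
        (\<lambda>s. gen D t s (X s \<omega>) (Y s \<omega>) (Z t s \<omega>) (u s \<omega>) \<omega>)) \<and>
     (\<exists>I. has_ito_integral M FF W r T (Z t) I \<and>
        (AE \<omega> in M. V \<omega> = bwd_free D t (X T \<omega>) \<omega>
           + (\<integral>s. gen D t s (X s \<omega>) (Y s \<omega>) (Z t s \<omega>) (u s \<omega>) \<omega> \<partial>lebesgue_on {r..T}) - I \<omega>))"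

text \<open>
  Joint measurability of \<open>X\<close> and \<open>Y\<close> is not part of \<open>CF_L2\<close>; it makes the integrals in time
  independent of the choice of versions.
\<close>

definition solves_state_equation ::
    "real \<Rightarrow> 'w measure \<Rightarrow> (real \<Rightarrow> 'w measure) \<Rightarrow> (real \<Rightarrow> 'w \<Rightarrow> real) \<Rightarrow>
     ('w, 'n::finite, 'm::finite, 'l::finite) volterra_data \<Rightarrow> (real \<Rightarrow> 'w \<Rightarrow> real ^ 'l) \<Rightarrow> (real \<Rightarrow> 'w \<Rightarrow> real ^ 'n) \<Rightarrow>
     (real \<Rightarrow> 'w \<Rightarrow> real ^ 'm) \<Rightarrow> (real \<Rightarrow> real \<Rightarrow> 'w \<Rightarrow> real ^ 'm) \<Rightarrow> bool" where
  "solves_state_equation T M FF W D u X Y Z \<longleftrightarrow>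
     X \<in> CF_L2 T M FF \<and> Y \<in> CF_L2 T M FF \<and> Z \<in> C_L2F T M FF \<and>
     (\<lambda>(t, \<omega>). X t \<omega>) \<in> borel_measurable (time_measure T \<Otimes>\<^sub>M FF T) \<and>
     (\<lambda>(t, \<omega>). Y t \<omega>) \<in> borel_measurable (time_measure T \<Otimes>\<^sub>M FF T) \<and>
     (\<forall>t\<in>{0..T}.
        (AE \<omega> in M. integrable (lebesgue_on {0..t}) (\<lambda>s. drift D t s (X s \<omega>) (u s \<omega>) \<omega>)) \<and>
        (\<exists>I. has_ito_integral M FF W 0 t (\<lambda>s \<omega>. diffusion D t s (X s \<omega>) (u s \<omega>) \<omega>) I \<and>
           (AE \<omega> in M. X t \<omega> = fwd_free D t \<omega>
              + (\<integral>s. drift D t s (X s \<omega>) (u s \<omega>) \<omega> \<partial>lebesgue_on {0..t}) + I \<omega>))) \<and>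
     (\<forall>t\<in>{0..T}. bwd_rhs T M FF W D u X Y Z t t (Y t)) \<and>
     (\<forall>t\<in>{0..T}. \<exists>\<eta>\<in>L2F_C T M FF. \<forall>r\<in>{0..T}. bwd_rhs T M FF W D u X Y Z t r (\<eta> r))"

definition is_state ::
    "real \<Rightarrow> 'w measure \<Rightarrow> (real \<Rightarrow> 'w measure) \<Rightarrow> (real \<Rightarrow> 'w \<Rightarrow> real) \<Rightarrow>
     ('w, 'n::finite, 'm::finite, 'l::finite) volterra_data \<Rightarrow> (real \<Rightarrow> 'w \<Rightarrow> real ^ 'l) \<Rightarrow> (real \<Rightarrow> 'w \<Rightarrow> real ^ 'n) \<Rightarrow>
     (real \<Rightarrow> 'w \<Rightarrow> real ^ 'm) \<Rightarrow> (real \<Rightarrow> real \<Rightarrow> 'w \<Rightarrow> real ^ 'm) \<Rightarrow> bool" where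
  "is_state T M FF W D u X Y Z \<longleftrightarrow>
     solves_state_equation T M FF W D u X Y Z \<and>
     (\<forall>X' Y' Z'. solves_state_equation T M FF W D u X' Y' Z' \<longrightarrow>
        (\<forall>t\<in>{0..T}. (AE \<omega> in M. X' t \<omega> = X t \<omega>) \<and> (AE \<omega> in M. Y' t \<omega> = Y t \<omega>) \<and>
           (AE (s, \<omega>) in time_measure T \<Otimes>\<^sub>M M. Z' t s \<omega> = Z t s \<omega>)))"

definition has_cost ::
    "real \<Rightarrow> 'w measure \<Rightarrow> (real \<Rightarrow> 'w measure) \<Rightarrow> (real \<Rightarrow> 'w \<Rightarrow> real) \<Rightarrow>
     ('w, 'n::finite, 'm::finite, 'l::finite) volterra_data \<Rightarrow> (real \<Rightarrow> 'w \<Rightarrow> real ^ 'l) \<Rightarrow> real \<Rightarrow> bool" where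
  "has_cost T M FF W D u c \<longleftrightarrow> (\<exists>X Y Z. is_state T M FF W D u X Y Z \<and>
     integrable (completion (time_measure T \<Otimes>\<^sub>M M))
       (\<lambda>(s, \<omega>). run_cost D s (X s \<omega>) (Y s \<omega>) (Z 0 s \<omega>) (u s \<omega>) \<omega>) \<and>
     integrable M (\<lambda>\<omega>. end_cost D (X T \<omega>) (Y 0 \<omega>) \<omega>) \<and>
     c = (\<integral>(s, \<omega>). run_cost D s (X s \<omega>) (Y s \<omega>) (Z 0 s \<omega>) (u s \<omega>) \<omega>
            \<partial>completion (time_measure T \<Otimes>\<^sub>M M))
       + (\<integral>\<omega>. end_cost D (X T \<omega>) (Y 0 \<omega>) \<omega> \<partial>M))"

definition cost ::
    "real \<Rightarrow> 'w measure \<Rightarrow> (real \<Rightarrow> 'w measure) \<Rightarrow> (real \<Rightarrow> 'w \<Rightarrow> real) \<Rightarrow>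
     ('w, 'n::finite, 'm::finite, 'l::finite) volterra_data \<Rightarrow> (real \<Rightarrow> 'w \<Rightarrow> real ^ 'l) \<Rightarrow> real" where
  "cost T M FF W D u = (THE c. has_cost T M FF W D u c)"

text \<open>
  The second conjunct says that the cost is a well-defined real-valued functional of the admissible
  control, in particular that each such control has a unique state. The infimum is taken in
  \<open>ereal\<close>, where it always exists.
\<close>

definition optimal_control ::
    "real \<Rightarrow> 'w measure \<Rightarrow> (real \<Rightarrow> 'w measure) \<Rightarrow> (real \<Rightarrow> 'w \<Rightarrow> real) \<Rightarrow> (real ^ 'l::finite) set \<Rightarrow>
     ('w, 'n::finite, 'm::finite, 'l::finite) volterra_data \<Rightarrow> (real \<Rightarrow> 'w \<Rightarrow> real ^ 'l) \<Rightarrow> bool" where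
  "optimal_control T M FF W U D u \<longleftrightarrow>
     u \<in> admissible T M FF U \<and>
     (\<forall>v\<in>admissible T M FF U. \<exists>!c. has_cost T M FF W D v c) \<and>
     ereal (cost T M FF W D u) = (INF v\<in>admissible T M FF U. ereal (cost T M FF W D v))"

end

theory Submission
  imports Defs
begin

text \<open>
  Suppose that \<open>F\<close> is negative somewhere on the adjacent cone of \<open>U\<close> at \<open>ubar\<close>, for a set of times and
  outcomes of positive measure. If one can choose at each such point, measurably and adaptedly, a
  bounded direction \<open>v\<close> in the cone with \<open>F \<bullet> v = -1\<close>, and puts \<open>v = 0\<close> elsewhere, then \<open>v\<close> should belong to
  the adjacent cone of the set of admissible controls, while the integral of \<open>F \<bullet> v\<close> is
  negative. This contradicts the hypothesis. Three things have to be supplied.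

  The selection. Membership in the cone at \<open>x\<close> is the vanishing of the upper limit of
  \<open>infdist (x + h v) U / h\<close>, a function that is Borel in \<open>x\<close> and Lipschitz in \<open>v\<close>
  (\<open>cone_gap_eq_0_iff\<close>, \<open>borel_measurable_cone_gap\<close>, \<open>cone_gap_lipschitz\<close>). Zeros in a compact set of
  such a function can be selected measurably in an elementary way, by taking the lexicographically
  least one (\<open>measurable_zero_selection\<close>). The result \<open>descent_selection\<close> is a Borel function of the pair
  \<open>(ubar, F)\<close>, and therefore inherits adaptedness from these processes.

  Joint measurability. The elements of \<open>L2F\<close> are jointly measurable for the final
  \<open>\<sigma>\<close>-algebra \<open>FF T\<close>, whereas \<open>F\<close> is jointly measurable for \<open>M\<close> and adapted. So \<open>F\<close> is first replaced by a
  modification that is jointly measurable for \<open>FF T\<close> (\<open>measurable_modification\<close>); it is still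
  adapted because the filtration contains the null sets.

  From pointwise to mean-square tangency. A bounded process with values in the pointwise cones is
  tangent to the set of admissible controls, by measurable almost-projection to \<open>U\<close> and dominated
  convergence (\<open>bounded_pointwise_tangent_in_L2_adjacent_cone\<close>).
\<close>

section \<open>Measurable selection of zeros\<close>

text \<open>
  For a fixed parameter the minimum of a continuous function over a compact set is its infimum over
  a countable dense subset, so the existence of a zero is a countable condition on the parameter.
  This is what makes a measurable projection theorem for general product sets unnecessary here.
\<close>

lemma sets_exists_zero:
  fixes g :: "'a \<Rightarrow> 'b::euclidean_space \<Rightarrow> real"
  assumes meas: "\<And>v. (\<lambda>x. g x v) \<in> borel_measurable N"
    and cont: "\<And>x. x \<in> space N \<Longrightarrow> continuous_on K (g x)"
    and nonneg: "\<And>x v. 0 \<le> g x v"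
    and K: "compact K"
  shows "{x \<in> space N. \<exists>v\<in>K. g x v = 0} \<in> sets N"
proof -
  obtain Q where Q: "countable Q" "Q \<subseteq> K" "K \<subseteq> closure Q"
    using separable[of K] by blast
  have "{x \<in> space N. \<exists>v\<in>K. g x v = 0} = {x \<in> space N. \<forall>n. \<exists>q\<in>Q. g x q < inverse (Suc n)}"
  proof (intro Collect_cong conj_cong refl iffI allI)
    fix x n assume x: "x \<in> space N" and "\<exists>v\<in>K. g x v = 0"
    then obtain v where v: "v \<in> K" "g x v = 0" by blast
    then obtain d where d: "d > 0" "\<And>w. w \<in> K \<Longrightarrow> dist w v < d \<Longrightarrow> dist (g x w) (g x v) < inverse (Suc n)"
      using cont[OF x] unfolding continuous_on_iff by (metis inverse_positive_iff_positive of_nat_0_less_iff zero_less_Suc)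
    obtain q where "q \<in> Q" "dist q v < d"
      using v Q d closure_approachable by blast
    then have "g x q < inverse (Suc n)" using d(2)[of q] Q v by (auto simp: dist_real_def)
    with \<open>q \<in> Q\<close> show "\<exists>q\<in>Q. g x q < inverse (Suc n)" by blast
  next
    fix x assume x: "x \<in> space N" and *: "\<forall>n. \<exists>q\<in>Q. g x q < inverse (Suc n)"
    then have "K \<noteq> {}" using Q by auto
    then obtain v where v: "v \<in> K" "\<And>w. w \<in> K \<Longrightarrow> g x v \<le> g x w"
      using continuous_attains_inf[OF K _ cont[OF x]] by blast
    have "g x v \<le> inverse (Suc n)" for n
      using * v(2) Q(2) by (meson less_eq_real_def order_le_less_trans subsetD)
    then have "g x v \<le> 0"
      by (intro LIMSEQ_le_const[OF LIMSEQ_inverse_real_of_nat]) auto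
    then show "\<exists>v\<in>K. g x v = 0" using nonneg[of x v] v by force
  qed
  also have "\<dots> \<in> sets N"
    using Q(1) meas by measurable
  finally show ?thesis .
qed

text \<open>
  The least value of one coordinate over the zero set is attained by compactness. It depends
  measurably on the parameter because it is at most \<open>a\<close> exactly if the half space
  \<open>{v. v \<bullet> b \<le> a}\<close> contains a zero.
\<close>

lemma measurable_zero_least_coordinate:
  fixes g :: "'a \<Rightarrow> 'b::euclidean_space \<Rightarrow> real"
  assumes meas: "\<And>v. (\<lambda>x. g x v) \<in> borel_measurable N"
    and cont: "\<And>x. x \<in> space N \<Longrightarrow> continuous_on K (g x)"
    and nonneg: "\<And>x v. 0 \<le> g x v"
    and K: "compact K"
    and ex: "\<And>x. x \<in> space N \<Longrightarrow> \<exists>v\<in>K. g x v = 0"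
  obtains c where "c \<in> borel_measurable N" "\<And>x. x \<in> space N \<Longrightarrow> \<exists>v\<in>K. g x v = 0 \<and> v \<bullet> b = c x"
proof -
  let ?Z = "\<lambda>x. {v\<in>K. g x v = 0}"
  have "\<exists>v\<in>?Z x. \<forall>w\<in>?Z x. v \<bullet> b \<le> w \<bullet> b" if x: "x \<in> space N" for x
  proof (rule continuous_attains_inf)
    have "closed (K \<inter> (g x) -` {0})"
      using cont[OF x] K compact_imp_closed by (intro continuous_closed_preimage) auto
    moreover have "?Z x = K \<inter> (K \<inter> (g x) -` {0})" by auto
    ultimately show "compact (?Z x)" using K by (metis compact_Int_closed)
    show "?Z x \<noteq> {}" using ex[OF x] by auto
  qed (intro continuous_intros)
  then obtain s where s: "\<And>x. x \<in> space N \<Longrightarrow> s x \<in> ?Z x"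
    "\<And>x w. x \<in> space N \<Longrightarrow> w \<in> ?Z x \<Longrightarrow> s x \<bullet> b \<le> w \<bullet> b" by metis
  show thesis
  proof
    have "{x \<in> space N. s x \<bullet> b \<le> a} \<in> sets N" for a
    proof -
      have "{x \<in> space N. s x \<bullet> b \<le> a} = {x \<in> space N. \<exists>v\<in>K \<inter> {v. v \<bullet> b \<le> a}. g x v = 0}"
        using s by fastforce
      also have "\<dots> \<in> sets N"
      proof (rule sets_exists_zero[OF meas _ nonneg])
        have "closed {v. v \<bullet> b \<le> a}" by (intro closed_Collect_le continuous_intros)
        then show "compact (K \<inter> {v. v \<bullet> b \<le> a})" using K by (rule compact_Int_closed[rotated])
      qed (meson cont continuous_on_subset inf_le1)
      finally show ?thesis .
    qed
    then show "(\<lambda>x. s x \<bullet> b) \<in> borel_measurable N" by (simp add: borel_measurable_iff_le)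
    show "\<exists>v\<in>K. g x v = 0 \<and> v \<bullet> b = s x \<bullet> b" if "x \<in> space N" for x
      using s(1)[OF that] by blast
  qed
qed

text \<open>
  The coordinates are fixed one after the other, each at the least value that the ones before it
  allow: a fixed coordinate is turned into one more summand \<open>\<bar>v \<bullet> b - c b x\<bar>\<close> of the function
  whose zeros are sought. The zero obtained at the end is the lexicographically least one.
\<close>

lemma measurable_zero_selection:
  fixes g :: "'a \<Rightarrow> 'b::euclidean_space \<Rightarrow> real"
  assumes meas: "\<And>v. (\<lambda>x. g x v) \<in> borel_measurable N"
    and cont: "\<And>x. x \<in> space N \<Longrightarrow> continuous_on K (g x)"
    and nonneg: "\<And>x v. 0 \<le> g x v"
    and K: "compact K"
    and ex: "\<And>x. x \<in> space N \<Longrightarrow> \<exists>v\<in>K. g x v = 0"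
  obtains s where "s \<in> borel_measurable N" "\<And>x. x \<in> space N \<Longrightarrow> s x \<in> K \<and> g x (s x) = 0"
proof -
  have "\<exists>c. (\<forall>b\<in>B. c b \<in> borel_measurable N) \<and>
      (\<forall>x\<in>space N. \<exists>v\<in>K. g x v = 0 \<and> (\<forall>b\<in>B. v \<bullet> b = c b x))" if "finite B" for B
    using that
  proof induction
    case empty
    show ?case using ex by auto
  next
    case (insert b B)
    then obtain c where c: "\<And>b. b \<in> B \<Longrightarrow> c b \<in> borel_measurable N"
      "\<And>x. x \<in> space N \<Longrightarrow> \<exists>v\<in>K. g x v = 0 \<and> (\<forall>b\<in>B. v \<bullet> b = c b x)" by blast
    define g' where "g' x v = g x v + (\<Sum>b\<in>B. \<bar>v \<bullet> b - c b x\<bar>)" for x v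
    have g'0: "g' x v = 0 \<longleftrightarrow> g x v = 0 \<and> (\<forall>b\<in>B. v \<bullet> b = c b x)" for x v
      unfolding g'_def using nonneg[of x v] insert.hyps(1)
      by (subst add_nonneg_eq_0_iff) (auto simp: sum_nonneg sum_nonneg_eq_0_iff)
    obtain d where d: "d \<in> borel_measurable N"
      "\<And>x. x \<in> space N \<Longrightarrow> \<exists>v\<in>K. g' x v = 0 \<and> v \<bullet> b = d x"
    proof (rule measurable_zero_least_coordinate[of g' N K b])
      show "(\<lambda>x. g' x v) \<in> borel_measurable N" for v
        unfolding g'_def using meas c(1) by measurable
      show "continuous_on K (g' x)" if "x \<in> space N" for x
        unfolding g'_def using cont[OF that] by (intro continuous_intros)
      show "0 \<le> g' x v" for x v
        unfolding g'_def using nonneg[of x v] by (simp add: sum_nonneg)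
      show "\<exists>v\<in>K. g' x v = 0" if "x \<in> space N" for x
        using c(2)[OF that] g'0 by blast
    qed (use K in auto)
    have "\<exists>v\<in>K. g x v = 0 \<and> (\<forall>b'\<in>insert b B. v \<bullet> b' = (c(b := d)) b' x)" if x: "x \<in> space N" for x
      using d(2)[OF x] insert.hyps(2) by (auto simp: g'0)
    moreover have "\<forall>b'\<in>insert b B. (c(b := d)) b' \<in> borel_measurable N"
      using c(1) d(1) by auto
    ultimately show ?case by blast
  qed
  from this[OF finite_Basis] obtain c where c: "\<And>b. b \<in> Basis \<Longrightarrow> c b \<in> borel_measurable N"
    "\<And>x. x \<in> space N \<Longrightarrow> \<exists>v\<in>K. g x v = 0 \<and> (\<forall>b\<in>(Basis::'b set). v \<bullet> b = c b x)" by blast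
  show thesis
  proof
    show "(\<lambda>x. \<Sum>b\<in>(Basis::'b set). c b x *\<^sub>R b) \<in> borel_measurable N" using c(1) by measurable
    fix x assume "x \<in> space N"
    then obtain v where v: "v \<in> K" "g x v = 0" "\<forall>b\<in>(Basis::'b set). v \<bullet> b = c b x" using c(2) by blast
    then have "(\<Sum>b\<in>(Basis::'b set). c b x *\<^sub>R b) = v"
      by (metis (no_types, lifting) euclidean_representation sum.cong)
    with v show "(\<Sum>b\<in>(Basis::'b set). c b x *\<^sub>R b) \<in> K \<and> g x (\<Sum>b\<in>(Basis::'b set). c b x *\<^sub>R b) = 0" by simp
  qed
qed

section \<open>The adjacent cone as the zero set of a Borel and Lipschitz function\<close>

text \<open>
  The truncation at \<open>1\<close> does not affect convergence to \<open>0\<close> and keeps the suprema below finite for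
  points away from \<open>K\<close>.
\<close>

definition trunc_quotient :: "'a::real_normed_vector set \<Rightarrow> 'a \<Rightarrow> 'a \<Rightarrow> real \<Rightarrow> real" where
  "trunc_quotient K x v h = min 1 (infdist (x + h *\<^sub>R v) K / h)"

text \<open>
  The upper limit of the truncated quotient as \<open>h\<close> decreases to \<open>0\<close>.
\<close>

definition cone_gap :: "'a::real_normed_vector set \<Rightarrow> 'a \<Rightarrow> 'a \<Rightarrow> real" where
  "cone_gap K x v = (INF n. SUP h\<in>{0<..inverse (real (Suc n))}. trunc_quotient K x v h)"

lemma trunc_quotient_bounds:
  assumes "0 < h"
  shows "0 \<le> trunc_quotient K x v h" "trunc_quotient K x v h \<le> 1"
  using assms by (auto simp: trunc_quotient_def infdist_nonneg)

lemma bdd_above_trunc_quotient: "bdd_above (trunc_quotient K x v ` {0<..r})"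
  by (rule bdd_aboveI[of _ 1]) (auto simp: trunc_quotient_bounds)

lemma SUP_trunc_quotient_nonneg:
  assumes "0 < r"
  shows "0 \<le> (SUP h\<in>{0<..r}. trunc_quotient K x v h)"
  using assms by (intro cSUP_upper2[OF bdd_above_trunc_quotient, of r]) (auto simp: trunc_quotient_bounds)

lemma bdd_below_SUP_trunc_quotient:
  "bdd_below (range (\<lambda>n. SUP h\<in>{0<..inverse (real (Suc n))}. trunc_quotient K x v h))"
  by (rule bdd_belowI[of _ 0]) (auto intro!: SUP_trunc_quotient_nonneg)

lemma cone_gap_nonneg: "0 \<le> cone_gap K x v"
  unfolding cone_gap_def by (intro cINF_greatest SUP_trunc_quotient_nonneg) auto

lemma trunc_quotient_lipschitz:
  assumes "0 < h"
  shows "trunc_quotient K x v h \<le> trunc_quotient K x w h + dist v w"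
proof -
  have "infdist (x + h *\<^sub>R v) K \<le> infdist (x + h *\<^sub>R w) K + dist (x + h *\<^sub>R v) (x + h *\<^sub>R w)"
    by (rule infdist_triangle)
  also have "dist (x + h *\<^sub>R v) (x + h *\<^sub>R w) = h * dist v w"
    using assms by (simp add: dist_norm scaleR_diff_right[symmetric])
  finally have "infdist (x + h *\<^sub>R v) K / h \<le> infdist (x + h *\<^sub>R w) K / h + dist v w"
    using assms by (simp add: field_simps)
  then show ?thesis unfolding trunc_quotient_def by (smt (verit) zero_le_dist)
qed

text \<open>
  Every quotient is \<open>1\<close>-Lipschitz in the direction \<open>v\<close>, uniformly in \<open>h\<close>, and this passes to the
  upper limit.
\<close>

lemma cone_gap_lipschitz: "cone_gap K x v \<le> cone_gap K x w + dist v w"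
proof -
  have "(SUP h\<in>{0<..r}. trunc_quotient K x v h) \<le> (SUP h\<in>{0<..r}. trunc_quotient K x w h) + dist v w"
    if r: "0 < r" for r
  proof (rule cSUP_least)
    fix h assume h: "h \<in> {0<..r}"
    then have "trunc_quotient K x w h \<le> (SUP h\<in>{0<..r}. trunc_quotient K x w h)"
      by (rule cSUP_upper[OF _ bdd_above_trunc_quotient])
    with h show "trunc_quotient K x v h \<le> (SUP h\<in>{0<..r}. trunc_quotient K x w h) + dist v w"
      using trunc_quotient_lipschitz[of h K x v w] by simp
  qed (use r in auto)
  then have "cone_gap K x v - dist v w \<le> (SUP h\<in>{0<..inverse (real (Suc n))}. trunc_quotient K x w h)" for n
    unfolding cone_gap_def
    using cINF_lower[OF bdd_below_SUP_trunc_quotient, of n K x v] by (smt (verit) UNIV_I inverse_positive_iff_positive of_nat_0_less_iff zero_less_Suc)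
  then have "cone_gap K x v - dist v w \<le> cone_gap K x w"
    unfolding cone_gap_def[of K x w] by (intro cINF_greatest) auto
  then show ?thesis by simp
qed

lemma continuous_on_cone_gap: "continuous_on S (cone_gap K x)"
proof -
  have "dist (cone_gap K x v) (cone_gap K x w) \<le> dist v w" for v w
    using cone_gap_lipschitz[of K x v w] cone_gap_lipschitz[of K x w v]
    by (simp add: dist_real_def dist_commute abs_le_iff)
  then show ?thesis
    unfolding continuous_on_iff by (meson order_le_less_trans)
qed

text \<open>
  A supremum of functions that are continuous in \<open>x\<close> has closed sublevel sets, although it is taken
  over uncountably many \<open>h\<close>.
\<close>

lemma borel_measurable_cone_gap: "(\<lambda>x. cone_gap K x v) \<in> borel_measurable borel"
proof -
  have "(\<lambda>x. SUP h\<in>{0<..r}. trunc_quotient K x v h) \<in> borel_measurable borel" if r: "0 < r" for r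
  proof -
    have "{x. (SUP h\<in>{0<..r}. trunc_quotient K x v h) \<le> a} \<in> sets borel" for a
    proof -
      have "{x. (SUP h\<in>{0<..r}. trunc_quotient K x v h) \<le> a} =
          (\<Inter>h\<in>{0<..r}. {x. trunc_quotient K x v h \<le> a})"
        using r by (auto simp: cSUP_le_iff[OF _ bdd_above_trunc_quotient])
      also have "closed \<dots>"
        unfolding trunc_quotient_def
        by (intro closed_INT ballI closed_Collect_le continuous_intros) auto
      finally show ?thesis by (rule borel_closed)
    qed
    then show ?thesis by (simp add: borel_measurable_iff_le)
  qed
  then show ?thesis
    unfolding cone_gap_def by (intro borel_measurable_cINF bdd_below_SUP_trunc_quotient) auto
qed

lemma cone_gap_eq_0_iff: "cone_gap K x v = 0 \<longleftrightarrow> v \<in> adjacent_cone K x"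
proof
  assume gap: "cone_gap K x v = 0"
  have "eventually (\<lambda>h. norm (infdist (x + h *\<^sub>R v) K / h) < e) (at_right 0)" if e: "0 < e" for e
  proof -
    have "cone_gap K x v < min 1 e" using gap e by simp
    then obtain n where n: "(SUP h\<in>{0<..inverse (real (Suc n))}. trunc_quotient K x v h) < min 1 e"
      unfolding cone_gap_def by (subst (asm) cINF_less_iff[OF _ bdd_below_SUP_trunc_quotient]) auto
    have "norm (infdist (x + h *\<^sub>R v) K / h) < e" if h: "h \<in> {0<..<inverse (real (Suc n))}" for h
    proof -
      have "trunc_quotient K x v h < min 1 e"
        using cSUP_upper[OF _ bdd_above_trunc_quotient, of h "inverse (real (Suc n))" K x v] n h
        by (simp del: of_nat_Suc)
      then have "infdist (x + h *\<^sub>R v) K / h < e"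
        unfolding trunc_quotient_def by linarith
      with h show ?thesis by (simp add: infdist_nonneg)
    qed
    then show ?thesis
      by (intro eventually_at_rightI[of 0 "inverse (real (Suc n))"]) auto
  qed
  then show "v \<in> adjacent_cone K x"
    unfolding adjacent_cone_def by (auto intro!: tendstoI simp: dist_norm)
next
  assume "v \<in> adjacent_cone K x"
  then have lim: "((\<lambda>h. infdist (x + h *\<^sub>R v) K / h) \<longlongrightarrow> 0) (at_right 0)"
    by (simp add: adjacent_cone_def)
  have "cone_gap K x v \<le> 0 + e" if e: "0 < e" for e
  proof -
    have "eventually (\<lambda>h. infdist (x + h *\<^sub>R v) K / h < e) (at_right 0)"
      using order_tendstoD(2)[OF lim e] .
    then obtain d where d: "0 < d" "\<And>h. 0 < h \<Longrightarrow> h < d \<Longrightarrow> infdist (x + h *\<^sub>R v) K / h < e"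
      unfolding eventually_at_right_field by auto
    obtain n where n: "inverse (real (Suc n)) < d" using reals_Archimedean d(1) by blast
    have "cone_gap K x v \<le> (SUP h\<in>{0<..inverse (real (Suc n))}. trunc_quotient K x v h)"
      unfolding cone_gap_def by (rule cINF_lower[OF bdd_below_SUP_trunc_quotient]) simp
    also have "\<dots> \<le> e"
    proof (rule cSUP_least)
      show "trunc_quotient K x v h \<le> e" if "h \<in> {0<..inverse (real (Suc n))}" for h
        using d(2)[of h] n that by (force simp: trunc_quotient_def)
    qed simp
    finally show ?thesis by simp
  qed
  then have "cone_gap K x v \<le> 0" by (rule field_le_epsilon)
  then show "cone_gap K x v = 0" using cone_gap_nonneg[of K x v] by simp
qed


lemma adjacent_cone_scaleR:
  assumes v: "v \<in> adjacent_cone K x" and c: "0 < c"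
  shows "c *\<^sub>R v \<in> adjacent_cone K x"
proof -
  have "((\<lambda>h. infdist (x + (c * h) *\<^sub>R v) K / (c * h)) \<longlongrightarrow> 0) (at_right 0)"
    using v c unfolding adjacent_cone_def
    by (auto intro!: filterlim_compose[OF _ filterlim_times_pos[of "\<lambda>h. h" 0 "at_right 0" c 0]] filterlim_ident)
  from tendsto_mult_right_zero[OF this, of c] show ?thesis
    using c by (simp add: adjacent_cone_def mult.commute)
qed

lemma zero_in_adjacent_cone:
  assumes "infdist x K = 0"
  shows "0 \<in> adjacent_cone K x"
  using assms by (simp add: adjacent_cone_def)

section \<open>Borel selection of descent directions\<close>

text \<open>
  The pairs \<open>(x, p)\<close> for which \<open>p\<close> is negative somewhere on the adjacent cone at \<open>x\<close>. As the cone is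
  invariant under positive scaling, the value can be normalised to \<open>-1\<close>; the bound \<open>r\<close> on the
  direction then makes the set of candidates compact.
\<close>

definition descent_set :: "'a::euclidean_space set \<Rightarrow> real \<Rightarrow> ('a \<times> 'a) set" where
  "descent_set U r = {(x, p). \<exists>v\<in>cball 0 r. v \<in> adjacent_cone U x \<and> p \<bullet> v = -1}"

lemma descent_set_exhausts:
  assumes "v \<in> adjacent_cone U x" "p \<bullet> v < 0"
  shows "\<exists>n. (x, p) \<in> descent_set U (real n)"
proof -
  define w where "w = (1 / (- (p \<bullet> v))) *\<^sub>R v"
  have "w \<in> adjacent_cone U x" unfolding w_def using assms by (intro adjacent_cone_scaleR) auto
  moreover have "p \<bullet> w = -1" using assms(2) by (simp add: w_def)
  moreover obtain n where "norm w \<le> real n" using real_arch_simple by blast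
  ultimately show ?thesis unfolding descent_set_def mem_Collect_eq case_prod_conv by (intro exI[of _ n] bexI[of _ w]) auto
qed

text \<open>
  The required directions are the zeros of \<open>cone_gap U x v + \<bar>p \<bullet> v + 1\<bar>\<close>, which is Borel in \<open>(x, p)\<close>
  and continuous in \<open>v\<close>. The selection is extended by \<open>0\<close>, which lies in the adjacent cone at every
  point of \<open>U\<close>.
\<close>

lemma descent_selection:
  fixes U :: "'a::euclidean_space set"
  assumes r: "0 \<le> r"
  obtains G where "descent_set U r \<in> sets borel" "G \<in> borel_measurable borel"
    "\<And>z. norm (G z) \<le> r"
    "\<And>x p. (x, p) \<in> descent_set U r \<Longrightarrow> G (x, p) \<in> adjacent_cone U x \<and> p \<bullet> G (x, p) = -1"
    "\<And>z. z \<notin> descent_set U r \<Longrightarrow> G z = 0"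
proof -
  define g where "g z v = cone_gap U (fst z) v + \<bar>snd z \<bullet> v + 1\<bar>" for z :: "'a \<times> 'a" and v
  have g0: "g z v = 0 \<longleftrightarrow> v \<in> adjacent_cone U (fst z) \<and> snd z \<bullet> v = -1" for z v
    using cone_gap_nonneg[of U "fst z" v] unfolding g_def cone_gap_eq_0_iff[symmetric] by auto
  have [measurable]: "(\<lambda>z. g z v) \<in> borel_measurable borel" for v
  proof -
    have [measurable]: "(\<lambda>z::'a \<times> 'a. cone_gap U (fst z) v) \<in> borel_measurable borel"
      by (rule measurable_compose[OF _ borel_measurable_cone_gap]) (intro borel_measurable_continuous_onI continuous_intros)
    have [measurable]: "(\<lambda>z::'a \<times> 'a. \<bar>snd z \<bullet> v + 1\<bar>) \<in> borel_measurable borel"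
      by (intro borel_measurable_continuous_onI continuous_intros)
    show ?thesis unfolding g_def by measurable
  qed
  have cont: "continuous_on S (g z)" for z S
    unfolding g_def by (intro continuous_intros continuous_on_cone_gap)
  have nonneg: "0 \<le> g z v" for z v
    unfolding g_def using cone_gap_nonneg[of U "fst z" v] by simp
  have set_eq: "descent_set U r = {z \<in> space borel. \<exists>v\<in>cball 0 r. g z v = 0}"
    by (auto simp: descent_set_def g0)
  have meas: "descent_set U r \<in> sets borel"
    unfolding set_eq by (rule sets_exists_zero) (use cont nonneg in auto)
  obtain s where s: "s \<in> borel_measurable (restrict_space borel (descent_set U r))"
    "\<And>z. z \<in> descent_set U r \<Longrightarrow> s z \<in> cball 0 r \<and> g z (s z) = 0"
  proof (rule measurable_zero_selection[of g "restrict_space borel (descent_set U r)" "cball 0 r"])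
    show "(\<lambda>z. g z v) \<in> borel_measurable (restrict_space borel (descent_set U r))" for v
      by (rule measurable_restrict_space1) measurable
    show "\<exists>v\<in>cball 0 r. g z v = 0" if "z \<in> space (restrict_space borel (descent_set U r))" for z
      using that by (simp add: set_eq space_restrict_space)
  qed (use cont nonneg in \<open>auto simp: space_restrict_space\<close>)
  show thesis
  proof (rule that[OF meas])
    show "(\<lambda>z. if z \<in> descent_set U r then s z else 0) \<in> borel_measurable borel"
      using s(1) meas by (subst (asm) measurable_restrict_space_iff) auto
  qed (use s(2) r g0 in force)+
qed

section \<open>Jointly measurable modifications\<close>

text \<open>
  Conditional expectations of the sections \<open>C\<^sub>t\<close> are determined only up to a null set depending on
  \<open>t\<close>. They can be chosen jointly measurable: for rectangles this is explicit, and the property is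
  stable under complements and countable disjoint unions.
\<close>

lemma conditional_section_probability:
  assumes "finite_measure M" "subalgebra M A" "C \<in> sets (N \<Otimes>\<^sub>M M)"
  obtains Y where "Y \<in> borel_measurable (N \<Otimes>\<^sub>M A)"
    "\<And>t. t \<in> space N \<Longrightarrow> AE \<omega> in M. Y (t, \<omega>) = nn_cond_exp M A (indicator (Pair t -` C)) \<omega>"
proof -
  interpret finite_measure_subalgebra M A
    using assms unfolding finite_measure_subalgebra_def finite_measure_subalgebra_axioms_def by simp
  have sub: "B \<in> sets A \<Longrightarrow> B \<in> sets M" for B using assms(2) by (auto simp: subalgebra_def)
  let ?P = "\<lambda>C. \<exists>Y \<in> borel_measurable (N \<Otimes>\<^sub>M A).
    \<forall>t\<in>space N. AE \<omega> in M. Y (t, \<omega>) = nn_cond_exp M A (indicator (Pair t -` C)) \<omega>"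
  have "C \<in> sigma_sets (space N \<times> space M) {S \<times> B | S B. S \<in> sets N \<and> B \<in> sets M}"
    using assms(3) by (simp add: sets_pair_measure)
  then have "?P C"
  proof (induction rule: sigma_sets_induct_disjoint[OF Int_stable_pair_measure_generator pair_measure_closed, consumes 1, case_names basic empty compl union])
    case (basic C)
    then obtain S B where C: "C = S \<times> B" and [measurable]: "S \<in> sets N" "B \<in> sets M" by blast
    show ?case
    proof (intro bexI ballI)
      show "(\<lambda>(t, \<omega>). indicator S t * nn_cond_exp M A (indicator B) \<omega>) \<in> borel_measurable (N \<Otimes>\<^sub>M A)"
        by measurable
      fix t assume "t \<in> space N"
      have "AE \<omega> in M. indicator {} \<omega> = nn_cond_exp M A (indicator {}) \<omega>"
        by (rule nn_cond_exp_F_meas) simp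
      moreover have "Pair t -` C = (if t \<in> S then B else {})" by (auto simp: C)
      ultimately show "AE \<omega> in M. (case (t, \<omega>) of (t, \<omega>) \<Rightarrow> indicator S t * nn_cond_exp M A (indicator B) \<omega>)
          = nn_cond_exp M A (indicator (Pair t -` C)) \<omega>"
        by (cases "t \<in> S") simp_all
    qed
  next
    case empty
    have "AE \<omega> in M. 0 = nn_cond_exp M A (\<lambda>_. 0) \<omega>"
      by (rule nn_cond_exp_F_meas) simp
    then show ?case
      by (intro bexI[of _ "\<lambda>_. 0"]) simp_all
  next
    case (compl C)
    then obtain Y where [measurable]: "Y \<in> borel_measurable (N \<Otimes>\<^sub>M A)"
      and Y: "\<And>t. t \<in> space N \<Longrightarrow> AE \<omega> in M. Y (t, \<omega>) = nn_cond_exp M A (indicator (Pair t -` C)) \<omega>" by blast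
    have C: "C \<in> sets (N \<Otimes>\<^sub>M M)" using compl by (simp add: sets_pair_measure)
    show ?case
    proof (intro bexI[of _ "\<lambda>p. 1 - Y p"] ballI)
      fix t assume t: "t \<in> space N"
      let ?C = "Pair t -` C" and ?D = "Pair t -` (space N \<times> space M - C)"
      have [measurable]: "?C \<in> sets M" using C by (rule sets_Pair1)
      have D: "?D = space M - ?C" using t by auto
      then have [measurable]: "?D \<in> sets M" by simp
      have "AE \<omega> in M. nn_cond_exp M A (indicator ?C) \<omega> + nn_cond_exp M A (indicator ?D) \<omega> =
          nn_cond_exp M A (\<lambda>\<omega>. indicator ?C \<omega> + indicator ?D \<omega>) \<omega>"
        by (rule nn_cond_exp_sum) auto
      moreover have "AE \<omega> in M. nn_cond_exp M A (\<lambda>\<omega>. indicator ?C \<omega> + indicator ?D \<omega>) \<omega> = nn_cond_exp M A (\<lambda>_. 1) \<omega>"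
      proof (rule nn_cond_exp_cong)
        show "AE \<omega> in M. indicator ?C \<omega> + indicator ?D \<omega> = (1::ennreal)"
          by (auto simp: D indicator_def)
      qed auto
      moreover have "AE \<omega> in M. 1 = nn_cond_exp M A (\<lambda>_. 1) \<omega>"
        by (rule nn_cond_exp_F_meas) simp
      ultimately show "AE \<omega> in M. 1 - Y (t, \<omega>) = nn_cond_exp M A (indicator ?D) \<omega>"
        using Y[OF t]
      proof eventually_elim
        case (elim \<omega>)
        then have "Y (t, \<omega>) + nn_cond_exp M A (indicator ?D) \<omega> = 1" by simp
        moreover from this have "Y (t, \<omega>) \<noteq> \<infinity>" by auto
        ultimately show ?case
          using ennreal_add_diff_cancel_left[of "Y (t, \<omega>)" "nn_cond_exp M A (indicator ?D) \<omega>"] by simp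
      qed
    qed measurable
  next
    case (union C)
    then have "\<forall>i. \<exists>Y. Y \<in> borel_measurable (N \<Otimes>\<^sub>M A) \<and> (\<forall>t\<in>space N. AE \<omega> in M. Y (t, \<omega>) = nn_cond_exp M A (indicator (Pair t -` C i)) \<omega>)" by blast
    then obtain Y where [measurable]: "\<And>i. Y i \<in> borel_measurable (N \<Otimes>\<^sub>M A)"
      and Y: "\<And>i t. t \<in> space N \<Longrightarrow> AE \<omega> in M. Y i (t, \<omega>) = nn_cond_exp M A (indicator (Pair t -` C i)) \<omega>"
      by metis
    have C: "C i \<in> sets (N \<Otimes>\<^sub>M M)" for i using union by (auto simp: sets_pair_measure)
    show ?case
    proof (intro bexI[of _ "\<lambda>p. \<Sum>i. Y i p"] ballI)
      fix t assume t: "t \<in> space N"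
      have [measurable]: "Pair t -` C i \<in> sets M" for i using C by (rule sets_Pair1)
      have [measurable]: "(\<lambda>\<omega>. Y i (t, \<omega>)) \<in> borel_measurable A" for i
        using t by measurable
      have [measurable]: "(\<lambda>\<omega>. Y i (t, \<omega>)) \<in> borel_measurable M" for i
        by (rule measurable_from_subalg[OF subalg]) measurable
      show "AE \<omega> in M. (\<Sum>i. Y i (t, \<omega>)) = nn_cond_exp M A (indicator (Pair t -` \<Union> (range C))) \<omega>"
      proof (rule nn_cond_exp_charact)
        fix B assume B: "B \<in> sets A"
        then have [measurable]: "B \<in> sets M" by (rule sub)
        have ind: "indicator (Pair t -` \<Union> (range C)) \<omega> = (\<Sum>i. indicator (Pair t -` C i) \<omega> :: ennreal)" for \<omega>
        proof -
          have "disjoint_family (\<lambda>i. Pair t -` C i)"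
            using \<open>disjoint_family C\<close> by (auto simp: disjoint_family_on_def)
          then show ?thesis by (subst suminf_indicator) (auto simp: vimage_Union)
        qed
        have "(\<integral>\<^sup>+\<omega>\<in>B. indicator (Pair t -` \<Union> (range C)) \<omega> \<partial>M)
            = (\<integral>\<^sup>+\<omega>. (\<Sum>i. indicator B \<omega> * indicator (Pair t -` C i) \<omega>) \<partial>M)"
          by (simp add: ind mult.commute)
        also have "\<dots> = (\<Sum>i. \<integral>\<^sup>+\<omega>. indicator B \<omega> * indicator (Pair t -` C i) \<omega> \<partial>M)"
          by (rule nn_integral_suminf) measurable
        also have "\<dots> = (\<Sum>i. \<integral>\<^sup>+\<omega>. indicator B \<omega> * nn_cond_exp M A (indicator (Pair t -` C i)) \<omega> \<partial>M)"
          using B by (subst nn_cond_exp_intg) auto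
        also have "\<dots> = (\<Sum>i. \<integral>\<^sup>+\<omega>. indicator B \<omega> * Y i (t, \<omega>) \<partial>M)"
        proof (intro suminf_cong nn_integral_cong_AE)
          show "AE \<omega> in M. indicator B \<omega> * nn_cond_exp M A (indicator (Pair t -` C i)) \<omega> = indicator B \<omega> * Y i (t, \<omega>)" for i
            using Y[OF t, of i] by eventually_elim simp
        qed
        also have "\<dots> = (\<integral>\<^sup>+\<omega>. (\<Sum>i. indicator B \<omega> * Y i (t, \<omega>)) \<partial>M)"
          by (rule nn_integral_suminf[symmetric]) measurable
        also have "\<dots> = (\<integral>\<^sup>+\<omega>\<in>B. (\<Sum>i. Y i (t, \<omega>)) \<partial>M)"
          by (simp add: mult.commute)
        finally show "(\<integral>\<^sup>+\<omega>\<in>B. indicator (Pair t -` \<Union> (range C)) \<omega> \<partial>M) = (\<integral>\<^sup>+\<omega>\<in>B. (\<Sum>i. Y i (t, \<omega>)) \<partial>M)" .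
      next
        have "Pair t -` \<Union> (range C) = (\<Union>i. Pair t -` C i)" by auto
        then show "(indicator (Pair t -` \<Union> (range C)) :: _ \<Rightarrow> ennreal) \<in> borel_measurable M" by simp
      qed measurable
    qed measurable
  qed
  then show thesis using that by blast
qed

text \<open>
  If all sections lie in \<open>A\<close>, then their conditional probabilities are almost surely \<open>0\<close> or \<open>1\<close>, and
  the places where the jointly measurable version equals \<open>1\<close> form the set sought.
\<close>

lemma measurable_set_modification:
  assumes "finite_measure M" "subalgebra M A" and C: "C \<in> sets (N \<Otimes>\<^sub>M M)"
    and sec: "\<And>t. t \<in> space N \<Longrightarrow> Pair t -` C \<in> sets A"
  obtains C' where "C' \<in> sets (N \<Otimes>\<^sub>M A)"
    "\<And>t. t \<in> space N \<Longrightarrow> AE \<omega> in M. (t, \<omega>) \<in> C' \<longleftrightarrow> (t, \<omega>) \<in> C"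
proof -
  interpret finite_measure_subalgebra M A
    using assms unfolding finite_measure_subalgebra_def finite_measure_subalgebra_axioms_def by simp
  obtain Y where [measurable]: "Y \<in> borel_measurable (N \<Otimes>\<^sub>M A)" and
    Y: "\<And>t. t \<in> space N \<Longrightarrow> AE \<omega> in M. Y (t, \<omega>) = nn_cond_exp M A (indicator (Pair t -` C)) \<omega>"
    using conditional_section_probability[OF assms(1-3)] by blast
  show thesis
  proof
    show "{p \<in> space (N \<Otimes>\<^sub>M A). Y p = 1} \<in> sets (N \<Otimes>\<^sub>M A)" by measurable
    fix t assume t: "t \<in> space N"
    have "AE \<omega> in M. indicator (Pair t -` C) \<omega> = nn_cond_exp M A (indicator (Pair t -` C)) \<omega>"
      using sec[OF t] by (intro nn_cond_exp_F_meas) simp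
    with Y[OF t] show "AE \<omega> in M. (t, \<omega>) \<in> {p \<in> space (N \<Otimes>\<^sub>M A). Y p = 1} \<longleftrightarrow> (t, \<omega>) \<in> C"
      using AE_space
    proof eventually_elim
      case (elim \<omega>)
      moreover have "space A = space M" using assms(2) by (simp add: subalgebra_def)
      ultimately show ?case using t by (auto simp: space_pair_measure indicator_def split: if_splits)
    qed
  qed
qed

text \<open>
  Each sublevel set at a rational level is modified separately, and the function is recovered as the
  infimum of the levels \<open>q\<close> with \<open>X < q\<close>. Off a null set of each section the modified sets agree with the
  original ones at all rational levels.
\<close>

lemma measurable_real_modification:
  fixes X :: "'t \<times> 'w \<Rightarrow> real"
  assumes "finite_measure M" "subalgebra M A" and X[measurable]: "X \<in> borel_measurable (N \<Otimes>\<^sub>M M)"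
    and sec: "\<And>t. t \<in> space N \<Longrightarrow> (\<lambda>\<omega>. X (t, \<omega>)) \<in> borel_measurable A"
  obtains X' where "X' \<in> borel_measurable (N \<Otimes>\<^sub>M A)"
    "\<And>t. t \<in> space N \<Longrightarrow> AE \<omega> in M. X' (t, \<omega>) = X (t, \<omega>)"
proof -
  have sp: "space A = space M" using assms(2) by (simp add: subalgebra_def)
  have "\<exists>C'. C' \<in> sets (N \<Otimes>\<^sub>M A) \<and>
      (\<forall>t\<in>space N. AE \<omega> in M. (t, \<omega>) \<in> C' \<longleftrightarrow> (t, \<omega>) \<in> {p \<in> space (N \<Otimes>\<^sub>M M). X p < q})" for q
  proof (rule measurable_set_modification[OF assms(1,2)])
    show "{p \<in> space (N \<Otimes>\<^sub>M M). X p < q} \<in> sets (N \<Otimes>\<^sub>M M)" by measurable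
    fix t assume t: "t \<in> space N"
    note [measurable] = sec[OF t]
    have "Pair t -` {p \<in> space (N \<Otimes>\<^sub>M M). X p < q} = {\<omega> \<in> space A. X (t, \<omega>) < q}"
      using t by (auto simp: sp space_pair_measure)
    also have "\<dots> \<in> sets A" by measurable
    finally show "Pair t -` {p \<in> space (N \<Otimes>\<^sub>M M). X p < q} \<in> sets A" .
  qed blast
  then have "\<forall>q. \<exists>C'. C' \<in> sets (N \<Otimes>\<^sub>M A) \<and>
      (\<forall>t\<in>space N. AE \<omega> in M. (t, \<omega>) \<in> C' \<longleftrightarrow> (t, \<omega>) \<in> {p \<in> space (N \<Otimes>\<^sub>M M). X p < q})"
    by (rule allI)
  from choice[OF this] obtain C where C': "\<And>q. C q \<in> sets (N \<Otimes>\<^sub>M A) \<and>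
      (\<forall>t\<in>space N. AE \<omega> in M. (t, \<omega>) \<in> C q \<longleftrightarrow> (t, \<omega>) \<in> {p \<in> space (N \<Otimes>\<^sub>M M). X p < q})"
    by blast
  then have [measurable]: "\<And>q. C q \<in> sets (N \<Otimes>\<^sub>M A)" by blast
  from C' have C: "AE \<omega> in M. (t, \<omega>) \<in> C q \<longleftrightarrow> (t, \<omega>) \<in> {p \<in> space (N \<Otimes>\<^sub>M M). X p < q}"
    if "t \<in> space N" for q t using that by blast
  define X' where "X' p = real_of_ereal (INF q\<in>\<rat>. if p \<in> C q then ereal q else \<infinity>)" for p
  show thesis
  proof
    show "X' \<in> borel_measurable (N \<Otimes>\<^sub>M A)"
      unfolding X'_def using countable_rat by measurable
    fix t assume t: "t \<in> space N"
    have "AE \<omega> in M. \<forall>q\<in>\<rat>. (t, \<omega>) \<in> C q \<longleftrightarrow> (t, \<omega>) \<in> {p \<in> space (N \<Otimes>\<^sub>M M). X p < q}"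
      using C[OF t] by (simp add: AE_ball_countable countable_rat)
    then show "AE \<omega> in M. X' (t, \<omega>) = X (t, \<omega>)"
      using AE_space
    proof eventually_elim
      case (elim \<omega>)
      have "(INF q\<in>\<rat>. if (t, \<omega>) \<in> C q then ereal q else \<infinity>) = ereal (X (t, \<omega>))"
      proof (rule antisym)
        show "(INF q\<in>\<rat>. if (t, \<omega>) \<in> C q then ereal q else \<infinity>) \<le> ereal (X (t, \<omega>))"
        proof (rule ereal_le_epsilon2)
          fix e :: real assume "0 < e"
          then obtain q where q: "q \<in> \<rat>" "X (t, \<omega>) < q" "q < X (t, \<omega>) + e"
            using Rats_dense_in_real[of "X (t, \<omega>)" "X (t, \<omega>) + e"] by auto
          then have "(t, \<omega>) \<in> C q" using elim t by (auto simp: space_pair_measure)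
          then have "(INF q\<in>\<rat>. if (t, \<omega>) \<in> C q then ereal q else \<infinity>) \<le> ereal q"
            using q(1) by (intro INF_lower2[of q]) auto
          also have "\<dots> \<le> ereal (X (t, \<omega>)) + ereal e" using q by simp
          finally show "(INF q\<in>\<rat>. if (t, \<omega>) \<in> C q then ereal q else \<infinity>) \<le> ereal (X (t, \<omega>)) + ereal e" .
        qed
        show "ereal (X (t, \<omega>)) \<le> (INF q\<in>\<rat>. if (t, \<omega>) \<in> C q then ereal q else \<infinity>)"
          using elim by (intro INF_greatest) auto
      qed
      then show ?case by (simp add: X'_def)
    qed
  qed
qed

text \<open>
  A process that is measurable for a large \<open>\<sigma>\<close>-algebra and has sections measurable for a smaller one
  need not be jointly measurable for the smaller one, but a modification of it is.
\<close>

lemma measurable_modification: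
  fixes X :: "'t \<times> 'w \<Rightarrow> 'h::euclidean_space"
  assumes "finite_measure M" "subalgebra M A" and X[measurable]: "X \<in> borel_measurable (N \<Otimes>\<^sub>M M)"
    and sec: "\<And>t. t \<in> space N \<Longrightarrow> (\<lambda>\<omega>. X (t, \<omega>)) \<in> borel_measurable A"
  obtains X' where "X' \<in> borel_measurable (N \<Otimes>\<^sub>M A)"
    "\<And>t. t \<in> space N \<Longrightarrow> AE \<omega> in M. X' (t, \<omega>) = X (t, \<omega>)"
proof -
  have "\<exists>Y. Y \<in> borel_measurable (N \<Otimes>\<^sub>M A) \<and> (\<forall>t\<in>space N. AE \<omega> in M. Y (t, \<omega>) = X (t, \<omega>) \<bullet> b)" for b
    by (rule measurable_real_modification[OF assms(1,2), of "\<lambda>p. X p \<bullet> b" N]) (use sec in auto)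
  then obtain Y where [measurable]: "\<And>b. Y b \<in> borel_measurable (N \<Otimes>\<^sub>M A)"
    and Y: "\<And>b t. t \<in> space N \<Longrightarrow> AE \<omega> in M. Y b (t, \<omega>) = X (t, \<omega>) \<bullet> b" by metis
  show thesis
  proof
    show "(\<lambda>p. \<Sum>b\<in>(Basis::'h set). Y b p *\<^sub>R b) \<in> borel_measurable (N \<Otimes>\<^sub>M A)" by measurable
    fix t assume "t \<in> space N"
    then have "AE \<omega> in M. \<forall>b\<in>(Basis::'h set). Y b (t, \<omega>) = X (t, \<omega>) \<bullet> b"
      using Y by (simp add: AE_finite_all)
    then show "AE \<omega> in M. (\<Sum>b\<in>(Basis::'h set). Y b (t, \<omega>) *\<^sub>R b) = X (t, \<omega>)"
      by eventually_elim (simp add: euclidean_representation)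
  qed
qed

lemma borel_measurable_pair_subalgebra:
  assumes "f \<in> borel_measurable (N \<Otimes>\<^sub>M A)" "subalgebra M A"
  shows "f \<in> borel_measurable (N \<Otimes>\<^sub>M M)"
proof -
  have "(\<lambda>\<omega>. \<omega>) \<in> measurable M A"
    using assms(2) by (auto simp: subalgebra_def measurable_def intro: sets.Int)
  then have "(\<lambda>p. (fst p, snd p)) \<in> measurable (N \<Otimes>\<^sub>M M) (N \<Otimes>\<^sub>M A)"
    by (intro measurable_Pair measurable_fst measurable_compose[OF measurable_snd])
  from measurable_compose[OF this assms(1)] show ?thesis by simp
qed

text \<open>
  This transfers adaptedness to modifications: the filtration contains all null sets, and the
  probability space is complete.
\<close>

lemma borel_measurable_AE_eq_subalgebra:
  fixes f g :: "'w \<Rightarrow> 'h::euclidean_space"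
  assumes "complete_measure M" "subalgebra M A" "null_sets M \<subseteq> sets A"
    and f: "f \<in> borel_measurable A" and g: "g \<in> borel_measurable M"
    and ae: "AE \<omega> in M. g \<omega> = f \<omega>"
  shows "g \<in> borel_measurable A"
proof (rule measurableI)
  interpret complete_measure M by fact
  have sp: "space A = space M" using assms(2) by (simp add: subalgebra_def)
  obtain Z where Z: "Z \<in> null_sets M" "{\<omega> \<in> space M. g \<omega> \<noteq> f \<omega>} \<subseteq> Z"
    using ae by (auto elim: AE_E simp: null_sets_def)
  fix S :: "'h set" assume S: "S \<in> sets borel"
  have "g -` S \<inter> Z \<inter> space M \<in> null_sets M"
    using Z(1) by (intro null_sets_subset[OF Z(1)] complete[OF _ Z(1)]) auto
  moreover have "g -` S \<inter> space A = (f -` S \<inter> space A - Z) \<union> (g -` S \<inter> Z \<inter> space M)"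
    using Z(2) by (auto simp: sp)
  moreover have "f -` S \<inter> space A \<in> sets A" using f S by (rule measurable_sets)
  ultimately show "g -` S \<inter> space A \<in> sets A"
    using Z(1) assms(3) by (metis sets.Diff sets.Un subsetD)
qed simp

section \<open>Mean-square tangency of pointwise tangent processes\<close>

text \<open>
  A nearest point need not be unique, so the first sufficiently good point of a countable dense
  subset of \<open>U\<close> is taken; the slack \<open>e\<close> guarantees that there is one.
\<close>

lemma borel_near_projection:
  fixes U :: "'a::euclidean_space set"
  assumes "U \<noteq> {}" "0 < e"
  obtains p where "p \<in> borel_measurable borel" "\<And>y. p y \<in> U" "\<And>y. dist y (p y) < infdist y U + e"
proof -
  obtain Q where Q: "countable Q" "Q \<subseteq> U" "U \<subseteq> closure Q"
    using separable[of U] by blast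
  then have "Q \<noteq> {}" using assms(1) by auto
  define q where "q = from_nat_into Q"
  have q: "range q = Q" using Q(1) \<open>Q \<noteq> {}\<close> unfolding q_def by (rule range_from_nat_into[rotated])
  have ex: "\<exists>n. dist y (q n) < infdist y U + e" for y
  proof -
    have "\<exists>u\<in>U. dist y u < infdist y U + e / 2"
      using assms cINF_less_iff[of U "dist y" "infdist y U + e / 2"] by (auto simp: infdist_notempty)
    then obtain u where u: "u \<in> U" "dist y u < infdist y U + e / 2" by blast
    then obtain n where "dist (q n) u < e / 2"
      using Q(3) q closure_approachable[of u Q] assms(2) by (metis half_gt_zero rangeE subsetD)
    with u show ?thesis
      using dist_triangle[of y "q n" u] by (intro exI[of _ n]) (auto simp: dist_commute)
  qed
  define n where "n y = (LEAST n. dist y (q n) < infdist y U + e)" for y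
  have [measurable]: "(\<lambda>y. infdist y U) \<in> borel_measurable borel"
    by (intro borel_measurable_continuous_onI continuous_intros)
  have [measurable]: "n \<in> measurable borel (count_space UNIV)"
    unfolding n_def by measurable
  show thesis
  proof
    show "(\<lambda>y. q (n y)) \<in> borel_measurable borel" by measurable
    show "q (n y) \<in> U" for y using q Q(2) by auto
    show "dist y (q (n y)) < infdist y U + e" for y
      unfolding n_def by (rule LeastI_ex[OF ex])
  qed
qed

lemma finite_measure_time_measure: "finite_measure (time_measure T)"
  by (rule finite_measureI) (simp add: time_measure_def emeasure_restrict_space space_restrict_space emeasure_lborel_Icc_eq)

lemma space_time_measure: "space (time_measure T) = {0..T}"
  by (simp add: time_measure_def space_restrict_space)

lemma nn_L2F_integral_eq_pair:
  assumes "finite_measure M" "(\<lambda>(t, \<omega>). X t \<omega>) \<in> borel_measurable (time_measure T \<Otimes>\<^sub>M M)"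
  shows "(\<integral>\<^sup>+\<omega>. (\<integral>\<^sup>+t. ennreal ((norm (X t \<omega>))\<^sup>2) \<partial>time_measure T) \<partial>M) =
    (\<integral>\<^sup>+p. ennreal ((norm (X (fst p) (snd p)))\<^sup>2) \<partial>(time_measure T \<Otimes>\<^sub>M M))"
proof -
  interpret N: finite_measure "time_measure T" by (rule finite_measure_time_measure)
  interpret M: finite_measure M by fact
  interpret pair_sigma_finite "time_measure T" M ..
  show ?thesis
    using assms(2) by (subst nn_integral_snd[symmetric]) (auto simp: split_beta')
qed

lemma L2_norm_eq_pair:
  assumes "finite_measure M"
    and "integrable (time_measure T \<Otimes>\<^sub>M M) (\<lambda>p. (norm (X (fst p) (snd p)))\<^sup>2)"
  shows "L2_norm T M X = sqrt (\<integral>p. (norm (X (fst p) (snd p)))\<^sup>2 \<partial>(time_measure T \<Otimes>\<^sub>M M))"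
proof -
  interpret N: finite_measure "time_measure T" by (rule finite_measure_time_measure)
  interpret M: finite_measure M by fact
  interpret pair_sigma_finite "time_measure T" M ..
  show ?thesis
    using integral_snd[of "\<lambda>t \<omega>. (norm (X t \<omega>))\<^sup>2"] assms(2)
    by (simp add: L2_norm_def split_beta')
qed

lemma L2F_if_norm_le_affine:
  assumes M: "finite_measure M" and sub: "subalgebra M (FF T)"
    and u: "u \<in> L2F T M FF"
    and k: "(\<lambda>(t, \<omega>). k t \<omega>) \<in> borel_measurable (time_measure T \<Otimes>\<^sub>M FF T)" "adapted T FF k"
    and le: "\<And>t \<omega>. norm (k t \<omega>) \<le> a * norm (u t \<omega>) + c"
  shows "k \<in> L2F T M FF"
proof -
  let ?P = "time_measure T \<Otimes>\<^sub>M M"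
  interpret P: finite_measure ?P
    by (intro finite_measure_pair_measure M finite_measure_time_measure)
  have u1: "(\<lambda>(t, \<omega>). u t \<omega>) \<in> borel_measurable ?P"
    using u sub by (auto simp: L2F_def intro: borel_measurable_pair_subalgebra)
  have k1: "(\<lambda>(t, \<omega>). k t \<omega>) \<in> borel_measurable ?P"
    using k sub by (auto intro: borel_measurable_pair_subalgebra)
  have [measurable]: "(\<lambda>p. u (fst p) (snd p)) \<in> borel_measurable ?P"
    using u1 by (simp add: split_beta')
  have "(\<integral>\<^sup>+p. ennreal ((norm (k (fst p) (snd p)))\<^sup>2) \<partial>?P)
      \<le> (\<integral>\<^sup>+p. ennreal (2 * a\<^sup>2) * ennreal ((norm (u (fst p) (snd p)))\<^sup>2) + ennreal (2 * c\<^sup>2) \<partial>?P)"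
  proof (intro nn_integral_mono)
    fix p
    let ?x = "norm (u (fst p) (snd p))"
    have "(norm (k (fst p) (snd p)))\<^sup>2 \<le> (a * ?x + c)\<^sup>2"
      using le by (intro power_mono) auto
    also have "\<dots> \<le> 2 * a\<^sup>2 * ?x\<^sup>2 + 2 * c\<^sup>2"
      using zero_le_power2[of "a * ?x - c"] by (simp add: power2_eq_square algebra_simps)
    finally show "ennreal ((norm (k (fst p) (snd p)))\<^sup>2) \<le> ennreal (2 * a\<^sup>2) * ennreal (?x\<^sup>2) + ennreal (2 * c\<^sup>2)"
      by (simp add: ennreal_mult[symmetric] ennreal_plus[symmetric] ennreal_leI del: ennreal_plus)
  qed
  also have "\<dots> = ennreal (2 * a\<^sup>2) * (\<integral>\<^sup>+p. ennreal ((norm (u (fst p) (snd p)))\<^sup>2) \<partial>?P)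
      + ennreal (2 * c\<^sup>2) * emeasure ?P (space ?P)"
    by (subst nn_integral_add) (auto simp: nn_integral_cmult)
  also have "\<dots> < \<infinity>"
  proof -
    have "(\<integral>\<^sup>+p. ennreal ((norm (u (fst p) (snd p)))\<^sup>2) \<partial>?P) < top"
      using u nn_L2F_integral_eq_pair[OF M u1] by (simp add: L2F_def)
    moreover have "emeasure ?P (space ?P) < top"
      using P.emeasure_finite[of "space ?P"] unfolding infinity_ennreal_def less_top .
    ultimately show ?thesis by (simp add: ennreal_mult_less_top)
  qed
  finally show ?thesis
    using k nn_L2F_integral_eq_pair[OF M k1] by (simp add: L2F_def)
qed

text \<open>
  Vanishing distance replaces membership in \<open>U\<close> because it gives a measurable subset of the product
  for arbitrary \<open>U\<close>, as is needed to exchange the two almost everywhere quantifiers.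
\<close>

lemma admissible_AE_infdist:
  assumes M: "finite_measure M" and sub: "subalgebra M (FF T)" and u: "u \<in> admissible T M FF U"
  shows "AE p in time_measure T \<Otimes>\<^sub>M M. infdist (u (fst p) (snd p)) U = 0"
proof -
  let ?P = "time_measure T \<Otimes>\<^sub>M M"
  interpret N: finite_measure "time_measure T" by (rule finite_measure_time_measure)
  interpret M: finite_measure M by fact
  interpret pair_sigma_finite "time_measure T" M ..
  have "(\<lambda>(t, \<omega>). u t \<omega>) \<in> borel_measurable ?P"
    using u sub by (auto simp: admissible_def L2F_def intro: borel_measurable_pair_subalgebra)
  then have [measurable]: "(\<lambda>p. u (fst p) (snd p)) \<in> borel_measurable ?P"
    by (simp add: split_beta')
  have [measurable]: "(\<lambda>y. infdist y U) \<in> borel_measurable borel"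
    by (intro borel_measurable_continuous_onI continuous_intros)
  have meas: "{p \<in> space ?P. infdist (u (fst p) (snd p)) U = 0} \<in> sets ?P" by measurable
  have "AE \<omega> in M. AE t in time_measure T. infdist (u t \<omega>) U = 0"
    using u unfolding admissible_def by (auto elim!: eventually_mono)
  then have "AE t in time_measure T. AE \<omega> in M. infdist (u t \<omega>) U = 0"
    using AE_commute[OF meas] by simp
  then show ?thesis using AE_pair_measure[OF meas] by simp
qed

text \<open>
  Projecting \<open>u + h v\<close> to \<open>U\<close> at every point, up to an error \<open>h\<^sup>2\<close>, gives an admissible control whose
  distance from \<open>u + h v\<close>, divided by \<open>h\<close>, tends to \<open>0\<close> pointwise. As the values of \<open>u\<close> are in the closure
  of \<open>U\<close> almost everywhere, these quotients are bounded by \<open>c + 1\<close> for \<open>h < 1\<close>, and dominated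
  convergence gives convergence in mean square.
\<close>

lemma bounded_pointwise_tangent_in_L2_adjacent_cone:
  fixes u v :: "real \<Rightarrow> 'w \<Rightarrow> real ^ 'l::finite"
  assumes M: "finite_measure M" and sub: "\<And>t. t \<in> {0..T} \<Longrightarrow> subalgebra M (FF t)" and T: "0 \<le> T"
    and U: "U \<noteq> {}" and u: "u \<in> admissible T M FF U" and v: "v \<in> L2F T M FF"
    and bound: "\<And>t \<omega>. norm (v t \<omega>) \<le> c"
    and cone: "AE p in time_measure T \<Otimes>\<^sub>M M. v (fst p) (snd p) \<in> adjacent_cone U (u (fst p) (snd p))"
  shows "v \<in> L2_adjacent_cone T M FF (admissible T M FF U) u"
proof -
  let ?P = "time_measure T \<Otimes>\<^sub>M M"
  interpret P: finite_measure ?P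
    by (intro finite_measure_pair_measure M finite_measure_time_measure)
  have subT: "subalgebra M (FF T)" using sub T by simp
  have u': "u \<in> L2F T M FF" using u by (simp add: admissible_def)
  have uvT: "(\<lambda>(t, \<omega>). u t \<omega>) \<in> borel_measurable (time_measure T \<Otimes>\<^sub>M FF T)"
      "(\<lambda>(t, \<omega>). v t \<omega>) \<in> borel_measurable (time_measure T \<Otimes>\<^sub>M FF T)"
    using u' v by (auto simp: L2F_def)
  then have [measurable]: "(\<lambda>p. u (fst p) (snd p)) \<in> borel_measurable (time_measure T \<Otimes>\<^sub>M FF T)"
      "(\<lambda>p. v (fst p) (snd p)) \<in> borel_measurable (time_measure T \<Otimes>\<^sub>M FF T)"
    by (auto simp: split_beta')
  have [measurable]: "(\<lambda>p. u (fst p) (snd p)) \<in> borel_measurable ?P"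
      "(\<lambda>p. v (fst p) (snd p)) \<in> borel_measurable ?P"
    using uvT[THEN borel_measurable_pair_subalgebra, OF subT] by (auto simp: split_beta')
  have "\<exists>p. p \<in> borel_measurable borel \<and> (\<forall>y. p y \<in> U \<and> dist y (p y) < infdist y U + h\<^sup>2)" if "h > 0" for h :: real
    by (rule borel_near_projection[OF U, of "h\<^sup>2"]) (use that in auto)
  then obtain p :: "real \<Rightarrow> real ^ 'l \<Rightarrow> real ^ 'l" where p[measurable]: "\<And>h. h > 0 \<Longrightarrow> p h \<in> borel_measurable borel"
    and pU: "\<And>h y. h > 0 \<Longrightarrow> p h y \<in> U"
    and pd: "\<And>h y. h > 0 \<Longrightarrow> dist y (p h y) < infdist y U + h\<^sup>2" by metis
  define k where "k h t \<omega> = p h (u t \<omega> + h *\<^sub>R v t \<omega>)" for h t \<omega>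
  define r where "r h t \<omega> = u t \<omega> + h *\<^sub>R v t \<omega> - k h t \<omega>" for h t \<omega>
  define Q where "Q h = sqrt (\<integral>q. (norm (r h (fst q) (snd q)) / h)\<^sup>2 \<partial>?P)" for h
  obtain u0 where u0: "u0 \<in> U" using U by blast
  have k_adm: "k h \<in> admissible T M FF U" if h: "h > 0" for h
  proof -
    note [measurable] = p[OF h]
    have "k h \<in> L2F T M FF"
    proof (rule L2F_if_norm_le_affine[OF M subT u'])
      show "(\<lambda>(t, \<omega>). k h t \<omega>) \<in> borel_measurable (time_measure T \<Otimes>\<^sub>M FF T)"
        unfolding k_def split_beta' by measurable
      show "adapted T FF (k h)"
        unfolding adapted_def
      proof
        fix t assume "t \<in> {0..T}"
        then have [measurable]: "u t \<in> borel_measurable (FF t)" "v t \<in> borel_measurable (FF t)"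
          using u' v by (auto simp: L2F_def adapted_def)
        show "k h t \<in> borel_measurable (FF t)"
          unfolding k_def by measurable
      qed
      fix t \<omega>
      let ?y = "u t \<omega> + h *\<^sub>R v t \<omega>"
      have "norm ?y \<le> norm (u t \<omega>) + h * c"
        using norm_triangle_ineq[of "u t \<omega>" "h *\<^sub>R v t \<omega>"] bound[of t \<omega>] h
        by (smt (verit) mult_left_mono norm_scaleR)
      moreover have "norm (k h t \<omega>) \<le> norm ?y + dist ?y (k h t \<omega>)"
        by (metis dist_commute dist_norm norm_triangle_sub)
      moreover have "dist ?y (k h t \<omega>) < infdist ?y U + h\<^sup>2"
        unfolding k_def by (rule pd[OF h])
      moreover have "infdist ?y U \<le> norm ?y + norm u0"
        using infdist_le[OF u0, of ?y] norm_triangle_ineq4[of ?y u0] by (simp add: dist_norm)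
      \<comment> \<open>The distance to \<open>U\<close> is at most the distance to the fixed point \<open>u0\<close>, so this holds everywhere and not only where \<open>u\<close> is in \<open>U\<close>.\<close>
      ultimately show "norm (k h t \<omega>) \<le> 2 * norm (u t \<omega>) + (2 * h * c + norm u0 + h\<^sup>2)" by simp
    qed
    then show ?thesis using pU[OF h] by (simp add: admissible_def k_def)
  qed
  have r_meas[measurable]: "(\<lambda>q. r h (fst q) (snd q)) \<in> borel_measurable ?P" if h: "h > 0" for h
    unfolding r_def k_def using p[OF h] by measurable
  have r_le: "norm (r h t \<omega>) / h \<le> infdist (u t \<omega> + h *\<^sub>R v t \<omega>) U / h + h" if h: "h > 0" for h t \<omega>
    using pd[OF h, of "u t \<omega> + h *\<^sub>R v t \<omega>"] h
    unfolding r_def k_def by (simp add: dist_norm field_simps power2_eq_square)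
  have AE_bound: "AE q in ?P. \<forall>h\<in>{0<..<1}. (norm (r h (fst q) (snd q)) / h)\<^sup>2 \<le> (c + 1)\<^sup>2"
    using admissible_AE_infdist[OF M subT u]
  proof eventually_elim
    case (elim q)
    show ?case
    proof
      fix h :: real assume h: "h \<in> {0<..<1}"
      let ?u = "u (fst q) (snd q)" and ?v = "v (fst q) (snd q)"
      have "infdist (?u + h *\<^sub>R ?v) U \<le> infdist ?u U + dist (?u + h *\<^sub>R ?v) ?u"
        by (rule infdist_triangle)
      also have "\<dots> = h * norm ?v" using elim h by (simp add: dist_norm)
      also have "\<dots> \<le> h * c" using bound h by (intro mult_left_mono) auto
      finally have "infdist (?u + h *\<^sub>R ?v) U / h \<le> c" using h by (simp add: field_simps)
      then have "norm (r h (fst q) (snd q)) / h \<le> c + 1"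
        using r_le[of h "fst q" "snd q"] h by auto
      then show "(norm (r h (fst q) (snd q)) / h)\<^sup>2 \<le> (c + 1)\<^sup>2"
        using h by (intro power_mono) auto
    qed
  qed
  have Q0: "(Q \<longlongrightarrow> 0) (at_right 0)"
  proof (rule tendsto_at_right_sequentially[of 0 1])
    fix S :: "nat \<Rightarrow> real" assume S: "\<And>n. 0 < S n" "\<And>n. S n < 1" "S \<longlonglongrightarrow> 0"
    moreover have "S n \<noteq> 0" for n using S(1)[of n] by simp
    ultimately have S0: "filterlim S (at_right 0) sequentially"
      by (auto simp: filterlim_at)
    have "(\<lambda>n. \<integral>q. (norm (r (S n) (fst q) (snd q)) / S n)\<^sup>2 \<partial>?P) \<longlonglongrightarrow> (\<integral>q. 0 \<partial>?P)"
    proof (rule integral_dominated_convergence[where w = "\<lambda>_. (c + 1)\<^sup>2"])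
      show "(\<lambda>q. (norm (r (S n) (fst q) (snd q)) / S n)\<^sup>2) \<in> borel_measurable ?P" for n
        using r_meas[OF S(1)] by measurable
      show "AE q in ?P. norm ((norm (r (S n) (fst q) (snd q)) / S n)\<^sup>2) \<le> (c + 1)\<^sup>2" for n
        using AE_bound by eventually_elim (use S in auto)
      show "AE q in ?P. (\<lambda>n. (norm (r (S n) (fst q) (snd q)) / S n)\<^sup>2) \<longlonglongrightarrow> 0"
        using cone
      proof eventually_elim
        case (elim q)
        let ?u = "u (fst q) (snd q)" and ?v = "v (fst q) (snd q)"
        have "(\<lambda>n. infdist (?u + S n *\<^sub>R ?v) U / S n + S n) \<longlonglongrightarrow> 0 + 0"
          using elim S0 S(3) unfolding adjacent_cone_def
          by (intro tendsto_add) (auto intro: filterlim_compose)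
        then have lim: "(\<lambda>n. infdist (?u + S n *\<^sub>R ?v) U / S n + S n) \<longlonglongrightarrow> 0" by simp
        have "(\<lambda>n. norm (r (S n) (fst q) (snd q)) / S n) \<longlonglongrightarrow> 0"
        proof (rule tendsto_sandwich[OF always_eventually always_eventually tendsto_const lim])
          show "\<forall>n. 0 \<le> norm (r (S n) (fst q) (snd q)) / S n"
            using S(1) by (simp add: less_imp_le)
          show "\<forall>n. norm (r (S n) (fst q) (snd q)) / S n \<le> infdist (?u + S n *\<^sub>R ?v) U / S n + S n"
            using r_le[OF S(1)] by blast
        qed
        from tendsto_power[OF this, of 2] show ?case by simp
      qed
    qed auto
    from tendsto_real_sqrt[OF this] show "(\<lambda>n. Q (S n)) \<longlonglongrightarrow> 0"
      by (simp add: Q_def)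
  qed simp
  have upper: "(INF k\<in>admissible T M FF U. L2_norm T M (\<lambda>t \<omega>. u t \<omega> + h *\<^sub>R v t \<omega> - k t \<omega>)) / h \<le> Q h"
    if h: "h \<in> {0<..<1}" for h
  proof -
    have h0: "h > 0" using h by simp
    note [measurable] = r_meas[OF h0]
    have "integrable ?P (\<lambda>q. (norm (r h (fst q) (snd q)) / h)\<^sup>2)"
    proof (rule P.integrable_const_bound[where B = "(c + 1)\<^sup>2"])
      show "AE q in ?P. norm ((norm (r h (fst q) (snd q)) / h)\<^sup>2) \<le> (c + 1)\<^sup>2"
        using AE_bound by eventually_elim (use h in auto)
    qed measurable
    then have "integrable ?P (\<lambda>q. h\<^sup>2 * (norm (r h (fst q) (snd q)) / h)\<^sup>2)" by simp
    then have int: "integrable ?P (\<lambda>q. (norm (r h (fst q) (snd q)))\<^sup>2)"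
      using h0 by (simp add: power_divide)
    have "bdd_below ((\<lambda>k. L2_norm T M (\<lambda>t \<omega>. u t \<omega> + h *\<^sub>R v t \<omega> - k t \<omega>)) ` admissible T M FF U)"
      by (rule bdd_belowI[of _ 0]) (auto simp: L2_norm_def intro!: integral_nonneg_AE)
    then have "(INF k\<in>admissible T M FF U. L2_norm T M (\<lambda>t \<omega>. u t \<omega> + h *\<^sub>R v t \<omega> - k t \<omega>)) \<le> L2_norm T M (r h)"
      unfolding r_def by (rule cINF_lower) (rule k_adm[OF h0])
    also have "L2_norm T M (r h) = h * Q h"
      using h0 unfolding L2_norm_eq_pair[OF M int] Q_def
      by (simp add: power_divide real_sqrt_divide)
    finally show ?thesis using h0 by (simp add: field_simps)
  qed
  have lower: "0 \<le> (INF k\<in>admissible T M FF U. L2_norm T M (\<lambda>t \<omega>. u t \<omega> + h *\<^sub>R v t \<omega> - k t \<omega>)) / h"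
    if "h \<in> {0<..<1}" for h
    using that u by (intro divide_nonneg_pos cINF_greatest) (auto simp: L2_norm_def intro!: integral_nonneg_AE)
  have "((\<lambda>h. (INF k\<in>admissible T M FF U. L2_norm T M (\<lambda>t \<omega>. u t \<omega> + h *\<^sub>R v t \<omega> - k t \<omega>)) / h) \<longlongrightarrow> 0) (at_right 0)"
    by (rule tendsto_sandwich[OF _ _ tendsto_const Q0]; rule eventually_at_rightI[of 0 1]; use lower upper in auto)
  then show ?thesis using v by (simp add: L2_adjacent_cone_def)
qed

section \<open>The pointwise condition\<close>

lemma AE_notin_if_integral_nonneg:
  assumes B: "B \<in> sets N" and f: "AE x in N. f x = - indicator B x"
    and nonneg: "0 \<le> ext_integral N f"
  shows "AE x in N. x \<notin> B"
proof -
  have "(\<integral>\<^sup>+x. ennreal (f x) \<partial>N) = (\<integral>\<^sup>+x. 0 \<partial>N)"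
    using f by (intro nn_integral_cong_AE) (auto elim!: eventually_mono simp: indicator_def ennreal_neg)
  moreover have "(\<integral>\<^sup>+x. ennreal (- f x) \<partial>N) = (\<integral>\<^sup>+x. indicator B x \<partial>N)"
    using f by (intro nn_integral_cong_AE) (auto elim!: eventually_mono simp: indicator_def)
  ultimately have "enn2ereal (emeasure N B) \<le> 0"
    using nonneg B by (simp add: ext_integral_def zero_ennreal.rep_eq)
  then have "emeasure N B = 0"
    by (metis antisym enn2ereal_nonneg enn2ereal_inject zero_ennreal.rep_eq)
  then show ?thesis using B by (intro AE_not_in) auto
qed

theorem lemma4p6:
  fixes T :: real
    and M :: "'w measure"
    and FF :: "real \<Rightarrow> 'w measure"
    and W :: "real \<Rightarrow> 'w \<Rightarrow> real"
    and U :: "(real ^ 'l::finite) set"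
    and D :: "('w, 'n::finite, 'm::finite, 'l) volterra_data"
    and ubar F :: "real \<Rightarrow> 'w \<Rightarrow> real ^ 'l"
  assumes "T > 0"
    and "wiener_space T M FF W"
    and "U \<noteq> {}" and "closed U"
    and "state_assumptions T M FF U D"
    and "cost_assumptions T M U D"
    and "optimal_control T M FF W U D ubar"
    and "(\<lambda>(t, \<omega>). F t \<omega>) \<in> borel_measurable (time_measure T \<Otimes>\<^sub>M M)"
    and "adapted T FF F"
    and "\<forall>v \<in> L2_adjacent_cone T M FF (admissible T M FF U) ubar.
           ext_integrable (time_measure T \<Otimes>\<^sub>M M) (\<lambda>(t, \<omega>). F t \<omega> \<bullet> v t \<omega>) \<and>
           0 \<le> ext_integral (time_measure T \<Otimes>\<^sub>M M) (\<lambda>(t, \<omega>). F t \<omega> \<bullet> v t \<omega>)"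
  shows "AE (t, \<omega>) in time_measure T \<Otimes>\<^sub>M M.
           \<forall>v \<in> adjacent_cone U (ubar t \<omega>). 0 \<le> F t \<omega> \<bullet> v"
proof -
  let ?P = "time_measure T \<Otimes>\<^sub>M M" and ?A = "time_measure T \<Otimes>\<^sub>M FF T"
  have complete: "complete_measure M" and usual: "usual_conditions T M FF" and prob: "prob_space M"
    using assms(2) by (auto simp: wiener_space_def)
  interpret prob_space M by fact
  have M: "finite_measure M" by (rule finite_measure_axioms)
  interpret N: finite_measure "time_measure T" by (rule finite_measure_time_measure)
  interpret pair_sigma_finite "time_measure T" M ..
  note usual' = usual[unfolded usual_conditions_def]
  have sub: "subalgebra M (FF t)" if "t \<in> {0..T}" for t
    using conjunct1[OF usual'] that by (simp add: subalgebra_def)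
  have mono: "sets (FF s) \<subseteq> sets (FF t)" if "0 \<le> s" "s \<le> t" "t \<le> T" for s t
    using conjunct1[OF conjunct2[OF usual']] that by simp
  have null: "null_sets M \<subseteq> sets (FF t)" if "t \<in> {0..T}" for t
    using conjunct1[OF conjunct2[OF conjunct2[OF usual']]] mono[of 0 t] that by auto
  have subT: "subalgebra M (FF T)" using sub assms(1) by simp
  have u: "ubar \<in> admissible T M FF U" using assms(7) by (simp add: optimal_control_def)
  then have u2: "ubar \<in> L2F T M FF" by (simp add: admissible_def)
  then have uT: "(\<lambda>(t, \<omega>). ubar t \<omega>) \<in> borel_measurable ?A" by (simp add: L2F_def)
  \<comment> \<open>The tangent direction below must be jointly measurable for \<open>FF T\<close>, whereas \<open>F\<close> is so for \<open>M\<close> only.\<close>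
  obtain F' where F': "F' \<in> borel_measurable ?A"
    "\<And>t. t \<in> space (time_measure T) \<Longrightarrow> AE \<omega> in M. F' (t, \<omega>) = F t \<omega>"
  proof (rule measurable_modification[OF M subT assms(8)])
    fix t assume "t \<in> space (time_measure T)"
    then have t: "t \<in> {0..T}" by (simp add: space_time_measure)
    have "subalgebra (FF T) (FF t)"
      using sub[OF t] subT mono[of t T] t by (auto simp: subalgebra_def)
    then show "(\<lambda>\<omega>. case (t, \<omega>) of (t, \<omega>) \<Rightarrow> F t \<omega>) \<in> borel_measurable (FF T)"
      using assms(9) t by (auto simp: adapted_def intro: measurable_from_subalg)
  qed auto
  have F'_adapted: "(\<lambda>\<omega>. F' (t, \<omega>)) \<in> borel_measurable (FF t)" if t: "t \<in> {0..T}" for t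
  proof (rule borel_measurable_AE_eq_subalgebra[OF complete sub[OF t] null[OF t]])
    show "F t \<in> borel_measurable (FF t)" using assms(9) t by (simp add: adapted_def)
    have "(\<lambda>\<omega>. F' (t, \<omega>)) \<in> borel_measurable (FF T)"
      using t F'(1) by (intro measurable_Pair2[of F'] ) (auto simp: space_time_measure)
    then show "(\<lambda>\<omega>. F' (t, \<omega>)) \<in> borel_measurable M" by (rule measurable_from_subalg[OF subT])
    show "AE \<omega> in M. F' (t, \<omega>) = F t \<omega>" using F'(2) t by (simp add: space_time_measure)
  qed
  note [measurable] = F'(1)
  have [measurable]: "F' \<in> borel_measurable ?P"
    by (rule borel_measurable_pair_subalgebra[OF F'(1) subT])
  have [measurable]: "(\<lambda>q. F (fst q) (snd q)) \<in> borel_measurable ?P"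
    using assms(8) by (simp add: split_beta')
  have [measurable]: "(\<lambda>q. ubar (fst q) (snd q)) \<in> borel_measurable ?A"
    using uT by (simp add: split_beta')
  have [measurable]: "(\<lambda>q. ubar (fst q) (snd q)) \<in> borel_measurable ?P"
    using borel_measurable_pair_subalgebra[OF uT subT] by (simp add: split_beta')
  have FF': "AE q in ?P. F' q = F (fst q) (snd q)"
    by (rule AE_pair_measure) (measurable, use F'(2) in simp)
  have "AE q in ?P. (ubar (fst q) (snd q), F' q) \<notin> descent_set U (real n)" for n
  proof -
    obtain G where G: "descent_set U (real n) \<in> sets borel" "G \<in> borel_measurable borel"
      "\<And>z. norm (G z) \<le> real n"
      "\<And>x p. (x, p) \<in> descent_set U (real n) \<Longrightarrow> G (x, p) \<in> adjacent_cone U x \<and> p \<bullet> G (x, p) = -1"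
      "\<And>z. z \<notin> descent_set U (real n) \<Longrightarrow> G z = 0"
      using descent_selection[of "real n" U] by auto
    note [measurable] = G(1,2)
    \<comment> \<open>A Borel function of adapted processes, so \<open>v\<close> is adapted and jointly measurable.\<close>
    define v where "v t \<omega> = G (ubar t \<omega>, F' (t, \<omega>))" for t \<omega>
    have "v \<in> L2F T M FF"
    proof (rule L2F_if_norm_le_affine[OF M subT u2])
      show "(\<lambda>(t, \<omega>). v t \<omega>) \<in> borel_measurable ?A"
        unfolding v_def split_beta' by (auto intro!: measurable_compose[OF _ G(2)] borel_measurable_Pair)
      show "adapted T FF v"
        unfolding adapted_def v_def using u2 F'_adapted
        by (auto intro!: measurable_compose[OF _ G(2)] borel_measurable_Pair simp: L2F_def adapted_def)
      show "norm (v t \<omega>) \<le> 0 * norm (ubar t \<omega>) + real n" for t \<omega>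
        using G(3) by (simp add: v_def)
    qed
    moreover have "AE q in ?P. v (fst q) (snd q) \<in> adjacent_cone U (ubar (fst q) (snd q))"
      using admissible_AE_infdist[OF M subT u]
    proof eventually_elim
      case (elim q)
      then show ?case using G(4,5) zero_in_adjacent_cone[OF elim] unfolding v_def by (metis prod.collapse)
    qed
    ultimately have "v \<in> L2_adjacent_cone T M FF (admissible T M FF U) ubar"
      using assms(1,3) G(3)
      by (intro bounded_pointwise_tangent_in_L2_adjacent_cone[OF M sub _ _ u, of _ "real n"]) (auto simp: v_def)
    then have nonneg: "0 \<le> ext_integral ?P (\<lambda>(t, \<omega>). F t \<omega> \<bullet> v t \<omega>)" using assms(10) by blast
    \<comment> \<open>Along \<open>v\<close> the integrand is \<open>-1\<close> on \<open>?B\<close> and \<open>0\<close> elsewhere, so its integral is minus the measure of \<open>?B\<close>.\<close>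
    let ?B = "{q \<in> space ?P. (ubar (fst q) (snd q), F' q) \<in> descent_set U (real n)}"
    have "AE q in ?P. q \<notin> ?B"
    proof (rule AE_notin_if_integral_nonneg[OF _ _ nonneg])
      have "(\<lambda>q. (ubar (fst q) (snd q), F' q)) \<in> borel_measurable ?P"
        by (intro borel_measurable_Pair) measurable
      from measurable_sets[OF this G(1)] show "?B \<in> sets ?P"
        by (simp add: vimage_def Int_def conj_commute)
      show "AE q in ?P. (case q of (t, \<omega>) \<Rightarrow> F t \<omega> \<bullet> v t \<omega>) = - indicator ?B q"
        using FF' AE_space
      proof eventually_elim
        case (elim q)
        then show ?case using G(4,5) by (cases q) (auto simp: v_def indicator_def)
      qed
    qed
    then show ?thesis using AE_space by eventually_elim auto
  qed
  then have "AE q in ?P. \<forall>n. (ubar (fst q) (snd q), F' q) \<notin> descent_set U (real n)"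
    by (simp add: AE_all_countable)
  with FF' show ?thesis
  proof eventually_elim
    case (elim q)
    then show ?case
      using descent_set_exhausts[of _ U "ubar (fst q) (snd q)" "F' q"] by (force simp: split_beta' not_less)
  qed
qed

end
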